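(* Let $X$ be an infinite, connected, locally finite, quasi-transitive simple graph possessing a graph height function $(h,\Gamma)$. Let $\mu(X)$ be the connective constant of $X$, and let $\beta(X,h)$ and $\overline{\beta}(X,h)$ be the bridge constant and the reversed bridge constant of $X$ with respect to $h$. Then $$\mu(X)=\max\{\beta(X,h),\overline{\beta}(X,h)\}.$$
   Context: A graph is a countable set of vertices $X$ with a symmetric neighbourhood relation $\sim$ (no loops, no multiple edges). It is locally finite if every vertex has finitely many neighbours. $\mathrm{AUT}(X)$ is the group of permutations $\sigma$ of $X$ with $u\sim v \iff \sigma(u)\sim\sigma(v)$. A subgroup $\Gamma\le \mathrm{AUT}(X)$ acts quasi-transitively if it has finitely many orbits on $X$; $X$ is quasi-transitive if $\mathrm{AUT}(X)$ acts quasi-transitively. A graph height function on $X$ is a pair $(h,\Gamma)$ such that: (i) $h:X\to\mathbb{Z}$; (ii) $\Gamma\le \mathrm{AUT}(X)$ is a subgroup acting quasi-transitively on $X$ and $h(\gamma v)-h(\gamma u)=h(v)-h(u)$ for all $\gamma\in\Gamma$ and $u,v\in X$; (iii) for every $v\in X$ there exist $u,w\in X$ adjacent to $v$ with $h(u)<h(v)<h(w)$. A walk of length $n\ge 0$ starting at $v$ is a sequence of vertices $(v_0,\dots,v_n)$ with $v_0=v$ and consecutive vertices adjacent; it is self-avoiding (a SAW) if no vertex occurs more than once. A SAW $(v=v_0,\dots,v_n)$ is a bridge if $h(v)<h(v_i)\le h(v_n)$ for all $1\le i\le n$, and a reversed bridge if $h(v)>h(v_i)\ge h(v_n)$ for all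 $1\le i\le n$; by convention the walk of length $0$ is both a bridge and a reversed bridge. Let $c_{n,v}$, $b_{n,v}$, $\overline{b}_{n,v}$ be the numbers of SAWs, bridges and reversed bridges of length $n$ starting at $v$, and put $c_n=\max_{v\in X}c_{n,v}$, $b_n=\min_{v\in X}b_{n,v}$, $\overline{b}_n=\min_{v\in X}\overline{b}_{n,v}$. The limits $$\mu(X)=\lim_{n\to\infty}c_n^{1/n},\quad \beta(X,h)=\lim_{n\to\infty}b_n^{1/n},\quad \overline{\beta}(X,h)=\lim_{n\to\infty}\overline{b}_n^{1/n}$$ exist (by sub-/super-multiplicativity). *)

theory Defs
  imports "HOL-Algebra.Group_Action" "HOL-Library.Countable_Set" Complex_Main
begin

locale simple_graph =
  fixes V :: "'a set" and adj :: "'a \<Rightarrow> 'a \<Rightarrow> bool"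
  assumes countable_verts: "countable V"
    and adj_verts: "adj u v \<Longrightarrow> u \<in> V \<and> v \<in> V"
    and adj_sym: "adj u v \<Longrightarrow> adj v u"
    and adj_irrefl: "\<not> adj v v"

definition locally_finite_graph :: "'a set \<Rightarrow> ('a \<Rightarrow> 'a \<Rightarrow> bool) \<Rightarrow> bool" where
  "locally_finite_graph V adj \<longleftrightarrow> (\<forall>v\<in>V. finite {u \<in> V. adj v u})"

text \<open>A walk of length \<open>n\<close> is the list of its \<open>n + 1\<close> vertices.\<close>

definition walks :: "'a set \<Rightarrow> ('a \<Rightarrow> 'a \<Rightarrow> bool) \<Rightarrow> nat \<Rightarrow> 'a \<Rightarrow> 'a list set" where
  "walks V adj n v =
     {p. length p = n + 1 \<and> p ! 0 = v \<and> set p \<subseteq> V \<and> (\<forall>i<n. adj (p ! i) (p ! (i + 1)))}"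

definition connected_graph :: "'a set \<Rightarrow> ('a \<Rightarrow> 'a \<Rightarrow> bool) \<Rightarrow> bool" where
  "connected_graph V adj \<longleftrightarrow> (\<forall>u\<in>V. \<forall>v\<in>V. \<exists>n. \<exists>p\<in>walks V adj n u. p ! n = v)"

definition aut_group :: "'a set \<Rightarrow> ('a \<Rightarrow> 'a \<Rightarrow> bool) \<Rightarrow> ('a \<Rightarrow> 'a) monoid" where
  "aut_group V adj =
     (BijGroup V)\<lparr>carrier := {\<sigma> \<in> Bij V. \<forall>u\<in>V. \<forall>v\<in>V. adj u v \<longleftrightarrow> adj (\<sigma> u) (\<sigma> v)}\<rparr>"

definition acts_quasi_transitively :: "('a \<Rightarrow> 'a) set \<Rightarrow> 'a set \<Rightarrow> bool" where
  "acts_quasi_transitively \<Gamma> V \<longleftrightarrow> finite (orbits ((BijGroup V)\<lparr>carrier := \<Gamma>\<rparr>) V (\<lambda>\<gamma>. \<gamma>))"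

definition quasi_transitive_graph :: "'a set \<Rightarrow> ('a \<Rightarrow> 'a \<Rightarrow> bool) \<Rightarrow> bool" where
  "quasi_transitive_graph V adj \<longleftrightarrow> acts_quasi_transitively (carrier (aut_group V adj)) V"

definition graph_height_function ::
    "'a set \<Rightarrow> ('a \<Rightarrow> 'a \<Rightarrow> bool) \<Rightarrow> ('a \<Rightarrow> int) \<Rightarrow> ('a \<Rightarrow> 'a) set \<Rightarrow> bool" where
  "graph_height_function V adj h \<Gamma> \<longleftrightarrow>
     subgroup \<Gamma> (aut_group V adj) \<and>
     acts_quasi_transitively \<Gamma> V \<and>
     (\<forall>\<gamma>\<in>\<Gamma>. \<forall>u\<in>V. \<forall>v\<in>V. h (\<gamma> v) - h (\<gamma> u) = h v - h u) \<and>
     (\<forall>v\<in>V. \<exists>u\<in>V. \<exists>w\<in>V. adj v u \<and> adj v w \<and> h u < h v \<and> h v < h w)"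

definition saws :: "'a set \<Rightarrow> ('a \<Rightarrow> 'a \<Rightarrow> bool) \<Rightarrow> nat \<Rightarrow> 'a \<Rightarrow> 'a list set" where
  "saws V adj n v = {p \<in> walks V adj n v. distinct p}"

definition bridges ::
    "'a set \<Rightarrow> ('a \<Rightarrow> 'a \<Rightarrow> bool) \<Rightarrow> ('a \<Rightarrow> int) \<Rightarrow> nat \<Rightarrow> 'a \<Rightarrow> 'a list set" where
  "bridges V adj h n v =
     {p \<in> saws V adj n v. \<forall>i\<in>{1..n}. h v < h (p ! i) \<and> h (p ! i) \<le> h (p ! n)}"

definition reversed_bridges ::
    "'a set \<Rightarrow> ('a \<Rightarrow> 'a \<Rightarrow> bool) \<Rightarrow> ('a \<Rightarrow> int) \<Rightarrow> nat \<Rightarrow> 'a \<Rightarrow> 'a list set" where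
  "reversed_bridges V adj h n v =
     {p \<in> saws V adj n v. \<forall>i\<in>{1..n}. h v > h (p ! i) \<and> h (p ! i) \<ge> h (p ! n)}"

text \<open>
  Each count below is constant on the orbits of \<open>AUT(X)\<close>, respectively \<open>\<Gamma>\<close>. So in the
  quasi-transitive case it takes finitely many values, and \<open>Max\<close> and \<open>Min\<close> are attained.
\<close>

definition max_saws :: "'a set \<Rightarrow> ('a \<Rightarrow> 'a \<Rightarrow> bool) \<Rightarrow> nat \<Rightarrow> nat" where
  "max_saws V adj n = (MAX v\<in>V. card (saws V adj n v))"

definition min_bridges :: "'a set \<Rightarrow> ('a \<Rightarrow> 'a \<Rightarrow> bool) \<Rightarrow> ('a \<Rightarrow> int) \<Rightarrow> nat \<Rightarrow> nat" where
  "min_bridges V adj h n = (MIN v\<in>V. card (bridges V adj h n v))"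

definition min_reversed_bridges ::
    "'a set \<Rightarrow> ('a \<Rightarrow> 'a \<Rightarrow> bool) \<Rightarrow> ('a \<Rightarrow> int) \<Rightarrow> nat \<Rightarrow> nat" where
  "min_reversed_bridges V adj h n = (MIN v\<in>V. card (reversed_bridges V adj h n v))"

definition connective_constant :: "'a set \<Rightarrow> ('a \<Rightarrow> 'a \<Rightarrow> bool) \<Rightarrow> real" where
  "connective_constant V adj = lim (\<lambda>n. root n (real (max_saws V adj n)))"

definition bridge_constant :: "'a set \<Rightarrow> ('a \<Rightarrow> 'a \<Rightarrow> bool) \<Rightarrow> ('a \<Rightarrow> int) \<Rightarrow> real" where
  "bridge_constant V adj h = lim (\<lambda>n. root n (real (min_bridges V adj h n)))"

definition reversed_bridge_constant ::
    "'a set \<Rightarrow> ('a \<Rightarrow> 'a \<Rightarrow> bool) \<Rightarrow> ('a \<Rightarrow> int) \<Rightarrow> real" where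
  "reversed_bridge_constant V adj h = lim (\<lambda>n. root n (real (min_reversed_bridges V adj h n)))"

end

theory Submission
  imports Defs "HOL-Real_Asymp.Real_Asymp"
begin

text \<open>  Write \<open>M\<close> for the larger of the two bridge constants. A bridge is a self-avoiding walk, so \<open>M \<le> \<mu>\<close>,
  and the content of the theorem is the bound \<open>\<mu> \<le> M\<close>, which follows the idea of Hammersley and
  Welsh: a self-avoiding walk of length \<open>n\<close> can be cut into \<open>O(\<surd>n)\<close> pieces, each of which is essentially
  a bridge or a reversed bridge.

  The cutting concerns only the sequence of heights along the walk (\<open>cuttable_sqrt\<close>). Starting at a strict
  extremum of that sequence, move to the last opposite extremum, then to the last opposite extremum of the
  rest, and so on. The height differences covered by these moves strictly decrease, so \<open>k\<close> of them add up
  to at least about \<open>k\<^sup>2 / 2\<close>. But a single step changes the height by a bounded amount, so they add up to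
  \<open>O(n)\<close>, and \<open>k = O(\<surd>n)\<close>.

  On \<open>\<int>\<^sup>d\<close> one would reflect every second piece and glue all of them to one long bridge. No reflection
  exists here, and none is needed as long as up and down pieces are counted by the larger constant \<open>M\<close>.
  A piece of length \<open>j\<close> can be chosen in at most \<open>B M\<^sup>j\<close> ways, where \<open>B\<close> depends neither on \<open>j\<close> nor on the
  starting vertex (\<open>card_pieces_le\<close>). Two facts give this bound. By Fekete's lemma the least number of bridges
  of length \<open>n\<close> is at most \<open>\<beta>\<^sup>n\<close> for every \<open>n\<close>, without any error factor. And the number of bridges from one
  vertex is controlled by the number of slightly longer bridges from any other vertex
  (\<open>card_bridges_compare\<close>), because a bridge of bounded length leads from each vertex into each orbit.

  Choosing the cut positions costs a factor \<open>n + 1\<close> per piece, so the number of self-avoiding walks of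
  length \<open>n\<close> is at most \<open>(B (n + 1))\<^sup>k M\<^sup>n\<close> with \<open>k = O(\<surd>n)\<close>. The first factor disappears in the \<open>n\<close>-th root.\<close>

section \<open>Growth rates\<close>

text \<open>  The bound \<open>a n \<le> s n\<close> holds because the limit is the supremum of the quotients \<open>a n / n\<close>. The upper bound
  on the number of bridges rests on this half, the convergence alone would not suffice.\<close>

lemma Fekete_superadditive:
  fixes a :: "nat \<Rightarrow> real"
  assumes super: "\<And>m n. a m + a n \<le> a (m + n)"
    and nonneg: "\<And>n. 0 \<le> a n" and bounded: "\<And>n. a n \<le> L * real n"
  shows "\<exists>s. (\<lambda>n. a n / real n) \<longlonglongrightarrow> s \<and> (\<forall>n. a n \<le> s * real n)"
proof -
  define s where "s = (SUP n\<in>{0<..}. a n / real n)"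
  have bdd: "bdd_above ((\<lambda>n. a n / real n) ` {0<..})"
    by (rule bdd_aboveI2[of _ _ L]) (use bounded in \<open>simp add: divide_simps\<close>)
  have le_s: "a n / real n \<le> s" if "n > 0" for n
    unfolding s_def using bdd that by (intro cSUP_upper) auto
  have mult: "real q * a m \<le> a (q * m)" for q m
  proof (induction q)
    case 0 show ?case using nonneg[of 0] by simp
  next
    case (Suc q) show ?case using Suc super[of m "q * m"] by (simp add: algebra_simps)
  qed
  \<comment> \<open>Divide \<open>n\<close> by \<open>m\<close> with remainder and drop the nonnegative contribution of the remainder.\<close>
  have lower: "a m / real m - a m / real n \<le> a n / real n" if "m > 0" "n > 0" for m n
  proof -
    have n: "real n = real (n div m) * real m + real (n mod m)"
      by (metis div_mult_mod_eq of_nat_add of_nat_mult)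
    have "real n - real m \<le> real (n div m) * real m"
      using n mod_less_divisor[OF that(1), of n] by linarith
    hence "(real n - real m) * (a m / real m) \<le> (real (n div m) * real m) * (a m / real m)"
      using nonneg[of m] by (intro mult_right_mono) simp_all
    also have "\<dots> = real (n div m) * a m" using that by simp
    also have "\<dots> \<le> a (n div m * m) + a (n mod m)"
      using mult[of "n div m" m] nonneg[of "n mod m"] by linarith
    also have "\<dots> \<le> a n"
      using super[of "n div m * m" "n mod m"] by simp
    finally have "(real n - real m) * (a m / real m) / real n \<le> a n / real n"
      by (intro divide_right_mono) auto
    moreover have "(real n - real m) * x / real n = x - real m * x / real n" for x
      using that by (simp add: diff_divide_distrib left_diff_distrib)
    moreover have "real m * (a m / real m) = a m" using that by simp
    ultimately show ?thesis by metis
  qed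
  have "(\<lambda>n. a n / real n) \<longlonglongrightarrow> s"
  proof (rule order_tendstoI)
    fix x assume "x < s"
    then obtain m where m: "m > 0" "x < a m / real m"
      unfolding s_def using less_cSUP_iff[OF _ bdd, of x] by (metis empty_iff greaterThan_iff lessI)
    have "(\<lambda>n. a m / real m - a m / real n) \<longlonglongrightarrow> a m / real m - 0"
      by (intro tendsto_diff tendsto_const lim_const_over_n)
    hence "eventually (\<lambda>n. x < a m / real m - a m / real n) sequentially"
      using m(2) by (simp add: order_tendstoD(1))
    thus "eventually (\<lambda>n. x < a n / real n) sequentially"
      using eventually_gt_at_top[of 0]
      by eventually_elim (rule less_le_trans[OF _ lower[OF m(1)]])
  next
    fix x assume "s < x"
    show "eventually (\<lambda>n. a n / real n < x) sequentially"
      using eventually_gt_at_top[of 0]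
      by eventually_elim (rule le_less_trans[OF le_s \<open>s < x\<close>])
  qed
  moreover have "a n \<le> s * real n" for n
    using le_s[of n] bounded[of 0] by (cases "n = 0") (auto simp: divide_simps)
  ultimately show ?thesis by blast
qed

lemma Fekete_supermultiplicative:
  fixes b :: "nat \<Rightarrow> nat"
  assumes super: "\<And>m n. b m * b n \<le> b (m + n)"
    and pos: "\<And>n. 1 \<le> b n" and bounded: "\<And>n. b n \<le> D ^ n"
  shows "\<exists>\<beta>\<ge>1. (\<lambda>n. root n (real (b n))) \<longlonglongrightarrow> \<beta> \<and> (\<forall>n. real (b n) \<le> \<beta> ^ n)"
proof -
  have pos': "real (b n) > 0" for n using pos[of n] by simp
  have "D > 0" using pos[of 1] bounded[of 1] by simp
  have "\<exists>s. (\<lambda>n. ln (real (b n)) / real n) \<longlonglongrightarrow> s \<and> (\<forall>n. ln (real (b n)) \<le> s * real n)"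
  proof (rule Fekete_superadditive)
    show "ln (real (b m)) + ln (real (b n)) \<le> ln (real (b (m + n)))" for m n
    proof -
      have "ln (real (b m)) + ln (real (b n)) = ln (real (b m * b n))"
        using pos'[of m] pos'[of n] by (simp add: ln_mult)
      also have "\<dots> \<le> ln (real (b (m + n)))"
      proof -
        have "real (b m * b n) \<le> real (b (m + n))" using super[of m n] by (rule of_nat_mono)
        moreover have "0 < real (b m * b n)" using pos'[of m] pos'[of n] by simp
        ultimately show ?thesis using pos'[of "m + n"] by (subst ln_le_cancel_iff)
      qed
      finally show ?thesis .
    qed
    show "0 \<le> ln (real (b n))" for n using pos[of n] by simp
    show "ln (real (b n)) \<le> ln (real D) * real n" for n
    proof -
      have "real (b n) \<le> real D ^ n" using bounded[of n] by (metis of_nat_le_iff of_nat_power)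
      hence "ln (real (b n)) \<le> ln (real D ^ n)" using pos'[of n] \<open>D > 0\<close> by simp
      thus ?thesis using \<open>D > 0\<close> by (simp add: ln_realpow mult.commute)
    qed
  qed
  then obtain s where s: "(\<lambda>n. ln (real (b n)) / real n) \<longlonglongrightarrow> s"
    and le: "\<And>n. ln (real (b n)) \<le> s * real n" by blast
  have "(\<lambda>n. exp (ln (real (b n)) / real n)) \<longlonglongrightarrow> exp s"
    using s by (intro tendsto_exp)
  moreover have "eventually (\<lambda>n. exp (ln (real (b n)) / real n) = root n (real (b n))) sequentially"
    using eventually_gt_at_top[of 0]
    by eventually_elim (use pos' in \<open>simp add: root_powr_inverse powr_def field_simps\<close>)
  ultimately have "(\<lambda>n. root n (real (b n))) \<longlonglongrightarrow> exp s"
    by (rule Lim_transform_eventually)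
  moreover have "real (b n) \<le> exp s ^ n" for n
  proof -
    have "real (b n) = exp (ln (real (b n)))" using pos'[of n] by simp
    also have "\<dots> \<le> exp (s * real n)" using le[of n] by simp
    finally show ?thesis by (simp add: exp_of_nat_mult[symmetric] mult.commute)
  qed
  moreover have "1 \<le> exp s" using le[of 1] pos[of 1] by (simp add: order_trans[of 0 "ln (real (b 1))" s])
  ultimately show ?thesis by blast
qed

text \<open>  The factor paid for cutting a walk is polynomial in \<open>n\<close> for each of \<open>O(\<surd>n)\<close> pieces, that is
  \<open>exp (O(\<surd>n log n))\<close>.\<close>

lemma sqrt_many_factors_negligible:
  fixes B d M :: real
  assumes "B \<ge> 1" "d > 0"
  shows "(\<lambda>n. (B * (real n + 1)) powr ((4 + 2 * sqrt (2 * d * real n)) / real n) * M) \<longlonglongrightarrow> M"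
proof -
  have "(\<lambda>n. (B * (real n + 1)) powr ((4 + 2 * sqrt (2 * d * real n)) / real n)) \<longlonglongrightarrow> 1"
    using assms by real_asymp
  from tendsto_mult_right[OF this, of M] show ?thesis by simp
qed

section \<open>Cutting integer sequences at their extrema\<close>

definition between_ends :: "(nat \<Rightarrow> int) \<Rightarrow> nat \<Rightarrow> nat \<Rightarrow> bool" where
  "between_ends f a b \<longleftrightarrow> (\<forall>i\<in>{a..b}. f a \<le> f i \<and> f i \<le> f b) \<or> (\<forall>i\<in>{a..b}. f b \<le> f i \<and> f i \<le> f a)"

text \<open>  Pieces of length zero are permitted, so the number of pieces can always be increased.\<close>

inductive cuttable :: "(nat \<Rightarrow> int) \<Rightarrow> nat \<Rightarrow> nat \<Rightarrow> nat \<Rightarrow> bool" for f where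
  cut_empty: "cuttable f 0 a a"
| cut_step: "a \<le> c \<Longrightarrow> between_ends f a c \<Longrightarrow> cuttable f k c b \<Longrightarrow> cuttable f (Suc k) a b"

lemma cuttable_le: "cuttable f k a b \<Longrightarrow> a \<le> b"
  by (induction rule: cuttable.induct) auto

lemma cuttable_single: "a \<le> b \<Longrightarrow> between_ends f a b \<Longrightarrow> cuttable f (Suc 0) a b"
  using cut_step cut_empty by blast

lemma cuttable_append: "cuttable f k a b \<Longrightarrow> cuttable f l b c \<Longrightarrow> cuttable f (k + l) a c"
  by (induction rule: cuttable.induct) (auto intro: cut_step)

lemma cuttable_pad: "cuttable f k a b \<Longrightarrow> k \<le> l \<Longrightarrow> cuttable f l a b"
proof (induction l)
  case (Suc l)
  have "between_ends f a a" by (auto simp: between_ends_def)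
  thus ?case using Suc cut_step[of a a f l b] by (cases "k = Suc l") auto
qed simp

lemma cuttable_shift: "cuttable f k (c + a) (c + b) \<Longrightarrow> cuttable (\<lambda>i. f (c + i)) k a b"
proof (induction k arbitrary: a)
  case 0
  hence "c + a = c + b" by (auto elim: cuttable.cases)
  thus ?case by (simp add: cut_empty)
next
  case (Suc k)
  from Suc.prems obtain e where e: "c + a \<le> e" "between_ends f (c + a) e" "cuttable f k e (c + b)"
    by (auto elim: cuttable.cases)
  define e' where "e' = e - c"
  have e': "e = c + e'" using e(1) by (simp add: e'_def)
  have "between_ends (\<lambda>i. f (c + i)) a e'"
    using e(2) unfolding e' between_ends_def by auto
  thus ?case using e Suc.IH[of e'] unfolding e' by (auto intro: cut_step)
qed

lemma cuttable_rev:
  assumes "cuttable f k a b" "b \<le> N"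
  shows "cuttable (\<lambda>i. f (N - i)) k (N - b) (N - a)"
  using assms
proof (induction rule: cuttable.induct)
  case (cut_empty a) show ?case by (rule cuttable.cut_empty)
next
  case (cut_step a c k b)
  have cb: "c \<le> b" using cut_step.hyps(3) by (rule cuttable_le)
  have eq: "N - (N - c) = c" "N - (N - a) = a" using cb cut_step by auto
  have rng: "N - i \<in> {a..c}" if "i \<in> {N - c..N - a}" for i using that cut_step cb by auto
  have "between_ends (\<lambda>i. f (N - i)) (N - c) (N - a)"
    using cut_step.hyps(2) rng unfolding between_ends_def eq by blast
  hence "cuttable (\<lambda>i. f (N - i)) (Suc 0) (N - c) (N - a)"
    using cut_step by (intro cuttable_single) auto
  from cuttable_append[OF cut_step.IH[OF cut_step.prems] this] show ?case by simp
qed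

lemma cuttable_uminus: "cuttable (\<lambda>i. - f i) k a b \<longleftrightarrow> cuttable f k a b"
proof -
  have *: "cuttable (\<lambda>i. - g i) k a b" if "cuttable g k a b" for g
    using that by (induction rule: cuttable.induct)
      (auto intro!: cuttable.intros simp: between_ends_def intro: cut_step)
  show ?thesis using *[of f] *[of "\<lambda>i. - f i"] by auto
qed

lemma cuttable_cong: "cuttable g k a b \<Longrightarrow> (\<And>i. i \<le> b \<Longrightarrow> g i = f i) \<Longrightarrow> cuttable f k a b"
proof (induction rule: cuttable.induct)
  case (cut_step a c k b)
  thus ?case using cuttable_le[OF cut_step.hyps(3)]
    by (intro cuttable.cut_step[of a c]) (auto simp: between_ends_def)
qed (rule cut_empty)

lemma small_steps_diff:
  fixes f :: "nat \<Rightarrow> int"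
  assumes "\<And>i. a \<le> i \<Longrightarrow> i < b \<Longrightarrow> \<bar>f (Suc i) - f i\<bar> \<le> d" "a \<le> b"
  shows "\<bar>f b - f a\<bar> \<le> d * int (b - a)"
  using assms(2,1)
proof (induction rule: dec_induct)
  case base show ?case by simp
next
  case (step n)
  have "\<bar>f n - f a\<bar> \<le> d * int (n - a)" using step by auto
  moreover have "\<bar>f (Suc n) - f n\<bar> \<le> d" using step by auto
  moreover have "int (Suc n - a) = int (n - a) + 1" using step by auto
  ultimately show ?case by (simp add: algebra_simps)
qed

text \<open>  Going to the last opposite extremum \<open>c\<close> makes \<open>c\<close> a strict extremum of the rest, which is the hypothesis
  needed to continue. Strictness also makes the next height difference smaller than the current one: the
  rest does not return to the value at \<open>a\<close>. The second conjunct, by which the number of pieces is at most one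
  more than the largest deviation from \<open>f a\<close>, is what the induction uses to bound the growth of \<open>k (k - 1)\<close>
  by the height difference of the first piece.\<close>

lemma cuttable_from_strict_extremum:
  fixes f :: "nat \<Rightarrow> int"
  assumes "a \<le> b" and "\<And>i. a \<le> i \<Longrightarrow> i < b \<Longrightarrow> \<bar>f (Suc i) - f i\<bar> \<le> d"
    and "(\<forall>i\<in>{a<..b}. f a < f i) \<or> (\<forall>i\<in>{a<..b}. f i < f a)"
  shows "\<exists>k. cuttable f k a b \<and> int k * (int k - 1) \<le> 2 * d * int (b - a) \<and>
    (\<forall>D. (\<forall>i\<in>{a..b}. \<bar>f i - f a\<bar> \<le> D) \<longrightarrow> int k \<le> D + 1)"
  using assms
proof (induction "b - a" arbitrary: a f rule: less_induct)
  case less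
  have main: "\<exists>k. cuttable g k a b \<and> int k * (int k - 1) \<le> 2 * d * int (b - a) \<and>
      (\<forall>D. (\<forall>i\<in>{a..b}. \<bar>g i - g a\<bar> \<le> D) \<longrightarrow> int k \<le> D + 1)"
    if step: "\<And>i. a \<le> i \<Longrightarrow> i < b \<Longrightarrow> \<bar>g (Suc i) - g i\<bar> \<le> d"
      and low: "\<forall>i\<in>{a<..b}. g a < g i" and "a < b" for g
  proof -
    define top where "top = Max (g ` {a..b})"
    have top: "g i \<le> top" if "i \<in> {a..b}" for i using that by (simp add: top_def)
    define c where "c = Max {i\<in>{a..b}. g i = top}"
    have "top \<in> g ` {a..b}" unfolding top_def using \<open>a < b\<close> by (intro Max_in) auto
    hence "c \<in> {i\<in>{a..b}. g i = top}" unfolding c_def by (intro Max_in) auto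
    hence c: "a \<le> c" "c \<le> b" "g c = top" by auto
    have "g a < top" using low[rule_format, of b] top[of b] \<open>a < b\<close> by simp
    hence "a < c" using c by (cases "a = c") auto
    have after: "g i < g c" if "i \<in> {c<..b}" for i
    proof -
      have "g i \<noteq> top"
      proof
        assume "g i = top"
        hence "i \<le> c" unfolding c_def using that c by (intro Max_ge) auto
        thus False using that by auto
      qed
      moreover have "g i \<le> top" using top that c by auto
      ultimately show ?thesis using c by simp
    qed
    obtain k where k: "cuttable g k c b" "int k * (int k - 1) \<le> 2 * d * int (b - c)"
      and kD: "\<And>D. (\<forall>i\<in>{c..b}. \<bar>g i - g c\<bar> \<le> D) \<Longrightarrow> int k \<le> D + 1"
    proof -
      have "b - c < b - a" using \<open>a < c\<close> c by simp
      from less.hyps[OF this c(2), of g] step after \<open>a < c\<close>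
      have "\<exists>k. cuttable g k c b \<and> int k * (int k - 1) \<le> 2 * d * int (b - c) \<and>
        (\<forall>D. (\<forall>i\<in>{c..b}. \<bar>g i - g c\<bar> \<le> D) \<longrightarrow> int k \<le> D + 1)" by simp
      thus ?thesis using that by blast
    qed
    have low': "\<forall>i\<in>{a..b}. g a \<le> g i" using low by (force simp: le_less)
    have "int k \<le> (g c - g a - 1) + 1"
    proof (rule kD, intro ballI)
      fix i assume i: "i \<in> {c..b}"
      have "g a < g i" using low i \<open>a < c\<close> by auto
      thus "\<bar>g i - g c\<bar> \<le> g c - g a - 1" using top[of i] c i by auto
    qed
    hence kc: "int k \<le> g c - g a" by simp
    have "\<bar>g c - g a\<bar> \<le> d * int (c - a)"
      using step c by (intro small_steps_diff) auto
    hence kd: "int k \<le> d * int (c - a)" using kc by linarith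
    have "between_ends g a c"
      unfolding between_ends_def using low' top c by auto
    hence "cuttable g (Suc k) a b" using k c by (intro cut_step) auto
    moreover have "int (Suc k) * (int (Suc k) - 1) \<le> 2 * d * int (b - a)"
    proof -
      have "int (b - a) = int (b - c) + int (c - a)" using c by auto
      thus ?thesis using k(2) kd by (simp add: algebra_simps)
    qed
    moreover have "int (Suc k) \<le> D + 1" if "\<forall>i\<in>{a..b}. \<bar>g i - g a\<bar> \<le> D" for D
    proof -
      have "\<bar>g c - g a\<bar> \<le> D" using that c by (metis atLeastAtMost_iff)
      thus ?thesis using kc by linarith
    qed
    ultimately show ?thesis by blast
  qed
  show ?case
  proof (cases "a = b")
    case True
    have "cuttable f 0 a b" using True cut_empty by simp
    thus ?thesis using True by force
  next
    case False
    hence "a < b" using less.prems by simp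
    from less.prems(3) show ?thesis
    proof
      assume "\<forall>i\<in>{a<..b}. f a < f i"
      thus ?thesis using main[of f] less.prems \<open>a < b\<close> by blast
    next
      assume *: "\<forall>i\<in>{a<..b}. f i < f a"
      have "\<exists>k. cuttable (\<lambda>i. - f i) k a b \<and> int k * (int k - 1) \<le> 2 * d * int (b - a) \<and>
        (\<forall>D. (\<forall>i\<in>{a..b}. \<bar>- f i - - f a\<bar> \<le> D) \<longrightarrow> int k \<le> D + 1)"
        using main[of "\<lambda>i. - f i"] less.prems(2) * \<open>a < b\<close> by (simp add: abs_minus_commute)
      thus ?thesis unfolding cuttable_uminus by (simp add: abs_minus_commute)
    qed
  qed
qed

lemma pronic_bound:
  assumes "int k * (int k - 1) \<le> 2 * d * int n" 
  shows "real k \<le> 1 + sqrt (2 * real_of_int d * real n)"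
proof (cases k)
  case (Suc j)
  have "int j * int j \<le> int k * (int k - 1)" using Suc by (simp add: algebra_simps)
  hence "int j * int j \<le> 2 * d * int n" using assms by linarith
  hence "real_of_int (int j * int j) \<le> real_of_int (2 * d * int n)" by (rule of_int_le_iff[THEN iffD2])
  hence "(real j)\<^sup>2 \<le> 2 * real_of_int d * real n" by (simp add: power2_eq_square)
  hence "real j \<le> sqrt (2 * real_of_int d * real n)" by (rule real_le_rsqrt)
  thus ?thesis using Suc by simp
next
  case 0
  have "0 \<le> d * int n" using assms 0 by simp
  hence "0 \<le> real_of_int (d * int n)" by linarith
  thus ?thesis using 0 by (simp add: add_increasing2)
qed

text \<open>  The sequence is cut at its first and its last maximum \<open>b'\<close> and \<open>b\<close>. Both are strict maxima as seen from
  outside, one to the left and one to the right, so the preceding lemma applies on either side. The stretch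
  between them needs two pieces, one down to a minimum \<open>c\<close> and one up again; hence the constant
  \<open>4 = 2 + 1 + 1\<close>.\<close>

lemma cuttable_sqrt:
  fixes f :: "nat \<Rightarrow> int"
  assumes step: "\<And>i. i < n \<Longrightarrow> \<bar>f (Suc i) - f i\<bar> \<le> d" and "0 \<le> d"
  shows "cuttable f (nat \<lfloor>4 + 2 * sqrt (2 * real_of_int d * real n)\<rfloor>) 0 n"
proof -
  define top where "top = Max (f ` {0..n})"
  define S where "S = {i\<in>{0..n}. f i = top}"
  have top: "f i \<le> top" if "i \<le> n" for i using that by (simp add: top_def)
  have "top \<in> f ` {0..n}" unfolding top_def by (intro Max_in) auto
  hence S: "finite S" "S \<noteq> {}" by (auto simp: S_def)
  define b where "b = Max S"
  define b' where "b' = Min S"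
  have bS: "b \<in> S" "b' \<in> S" "b' \<le> b" using S by (auto simp: b_def b'_def)
  hence b: "b \<le> n" "b' \<le> n" "f b = top" "f b' = top" by (auto simp: S_def)
  have less: "f i < top" if "i \<le> n" "i \<notin> S" for i
    using that top[of i] by (auto simp: S_def)
  have right: "\<forall>i\<in>{b<..n}. f i < f b"
  proof
    fix i assume i: "i \<in> {b<..n}"
    hence "i \<notin> S" using Max_ge[OF S(1), of i] by (auto simp: b_def)
    thus "f i < f b" using less i b by auto
  qed
  obtain k where k: "cuttable f k b n" "int k * (int k - 1) \<le> 2 * d * int (n - b)"
    using cuttable_from_strict_extremum[of b n f d] right step b by auto
  have left: "\<forall>i\<in>{0<..b'}. f (b' - i) < f (b' - 0)"
  proof
    fix i assume i: "i \<in> {0<..b'}"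
    hence "b' - i \<notin> S" using Min_le[OF S(1), of "b' - i"] by (auto simp: b'_def)
    thus "f (b' - i) < f (b' - 0)" using less i b by auto
  qed
  have step': "\<bar>f (b' - Suc i) - f (b' - i)\<bar> \<le> d" if "i < b'" for i
    using step[of "b' - Suc i"] that b by (simp add: Suc_diff_Suc abs_minus_commute)
  obtain l where l: "cuttable (\<lambda>i. f (b' - i)) l 0 b'" "int l * (int l - 1) \<le> 2 * d * int (b' - 0)"
    using cuttable_from_strict_extremum[of 0 b' "\<lambda>i. f (b' - i)" d] left step' by auto
  have l': "cuttable f l 0 b'"
  proof -
    have "cuttable (\<lambda>i. f (b' - (b' - i))) l 0 b'" using cuttable_rev[OF l(1), of b'] by simp
    thus ?thesis by (rule cuttable_cong) simp
  qed
  define c where "c = arg_min_on f {b'..b}"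
  have c: "c \<in> {b'..b}" "\<And>i. i \<in> {b'..b} \<Longrightarrow> f c \<le> f i"
    unfolding c_def using bS arg_min_if_finite(1)[of "{b'..b}" f] arg_min_least[of "{b'..b}" _ f] by auto
  have "between_ends f b' c" "between_ends f c b"
    unfolding between_ends_def using c b top by auto
  hence "cuttable f (l + (Suc 0 + (Suc 0 + k))) 0 n"
    using c l' k by (intro cuttable_append[OF l'] cuttable_append[OF cuttable_single] k(1)) auto
  moreover have "l + (Suc 0 + (Suc 0 + k)) \<le> nat \<lfloor>4 + 2 * sqrt (2 * real_of_int d * real n)\<rfloor>"
  proof -
    have mono: "2 * d * int m \<le> 2 * d * int n" if "m \<le> n" for m
      using that \<open>0 \<le> d\<close> by (intro mult_left_mono) auto
    have "real k \<le> 1 + sqrt (2 * real_of_int d * real n)"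
      using k(2) mono[of "n - b"] by (intro pronic_bound) auto
    moreover have "real l \<le> 1 + sqrt (2 * real_of_int d * real n)"
      using l(2) mono[of "b'"] b by (intro pronic_bound) auto
    ultimately have "real (l + (Suc 0 + (Suc 0 + k))) \<le> 4 + 2 * sqrt (2 * real_of_int d * real n)"
      by simp
    thus ?thesis by (rule le_nat_floor)
  qed
  ultimately show ?thesis by (rule cuttable_pad)
qed

section \<open>Graphs with a height function and their symmetries\<close>

text \<open>  Loop erasure: if the new first element already occurs in the chain, the chain is started there.\<close>

lemma distinct_chain_if_rtranclp:
  assumes "R\<^sup>*\<^sup>* x y"
  shows "\<exists>n p. length p = Suc n \<and> p ! 0 = x \<and> p ! n = y \<and> distinct p \<and> (\<forall>i<n. R (p ! i) (p ! Suc i))"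
  using assms
proof (induction rule: converse_rtranclp_induct)
  case base
  show ?case by (rule exI[of _ 0], rule exI[of _ "[y]"]) simp
next
  case (step x u)
  then obtain n p where p: "length p = Suc n" "p ! 0 = u" "p ! n = y" "distinct p"
    "\<forall>i<n. R (p ! i) (p ! Suc i)" by blast
  show ?case
  proof (cases "x \<in> set p")
    case True
    then obtain j where j: "j < Suc n" "p ! j = x" using p(1) by (metis in_set_conv_nth)
    have "length (drop j p) = Suc (n - j) \<and> drop j p ! 0 = x \<and> drop j p ! (n - j) = y \<and>
        distinct (drop j p) \<and> (\<forall>i<n - j. R (drop j p ! i) (drop j p ! Suc i))"
      using p j by auto
    thus ?thesis by blast
  next
    case False
    have "R ((x # p) ! i) ((x # p) ! Suc i)" if "i < Suc n" for i
      using that p step.hyps by (cases i) auto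
    hence "length (x # p) = Suc (Suc n) \<and> (x # p) ! 0 = x \<and> (x # p) ! Suc n = y \<and>
        distinct (x # p) \<and> (\<forall>i<Suc n. R ((x # p) ! i) ((x # p) ! Suc i))"
      using p False by simp
    thus ?thesis by blast
  qed
qed

locale height_graph =
  fixes V :: "'a set" and adj :: "'a \<Rightarrow> 'a \<Rightarrow> bool"
    and h :: "'a \<Rightarrow> int" and \<Gamma> :: "('a \<Rightarrow> 'a) set"
  assumes simple: "simple_graph V adj"
    and nonempty: "V \<noteq> {}"
    and connected: "connected_graph V adj"
    and loc_finite: "locally_finite_graph V adj"
    and height: "graph_height_function V adj h \<Gamma>"
begin

lemma adj_V: "adj u v \<Longrightarrow> u \<in> V" "adj u v \<Longrightarrow> v \<in> V"
  using simple by (auto simp: simple_graph_def)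

lemma adj_commute: "adj u v \<Longrightarrow> adj v u"
  using simple by (auto simp: simple_graph_def)

lemma subgroup_\<Gamma>: "subgroup \<Gamma> (aut_group V adj)"
  using height by (simp add: graph_height_function_def)

lemma group_aut: "group (aut_group V adj)"
proof -
  define A where "A = {\<sigma> \<in> Bij V. \<forall>u\<in>V. \<forall>v\<in>V. adj u v \<longleftrightarrow> adj (\<sigma> u) (\<sigma> v)}"
  interpret G: group "BijGroup V" by (rule group_BijGroup)
  have inV: "\<sigma> x \<in> V" if "\<sigma> \<in> Bij V" "x \<in> V" for \<sigma> x
    using Bij_imp_funcset[OF that(1)] that(2) by auto
  have "subgroup A (BijGroup V)"
  proof (rule G.subgroupI)
    show "A \<subseteq> carrier (BijGroup V)" by (auto simp: A_def BijGroup_def)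
    have "(\<lambda>x\<in>V. x) \<in> A" by (auto simp: A_def id_Bij)
    thus "A \<noteq> {}" by blast
  next
    fix \<sigma> assume \<sigma>: "\<sigma> \<in> A"
    hence bij: "\<sigma> \<in> Bij V" by (simp add: A_def)
    have surj: "\<sigma> ` V = V" using bij by (simp add: Bij_def bij_betw_def)
    have "adj u v \<longleftrightarrow> adj (inv_into V \<sigma> u) (inv_into V \<sigma> v)" if "u \<in> V" "v \<in> V" for u v
    proof -
      have "adj (inv_into V \<sigma> u) (inv_into V \<sigma> v) \<longleftrightarrow>
          adj (\<sigma> (inv_into V \<sigma> u)) (\<sigma> (inv_into V \<sigma> v))"
        using \<sigma> Bij_inv_into_mem[OF bij] that by (simp add: A_def)
      thus ?thesis using that surj by (simp add: f_inv_into_f)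
    qed
    thus "inv\<^bsub>BijGroup V\<^esub> \<sigma> \<in> A"
      using bij by (simp add: inv_BijGroup A_def restrict_inv_into_Bij)
  next
    fix \<sigma> \<tau> assume "\<sigma> \<in> A" "\<tau> \<in> A"
    thus "\<sigma> \<otimes>\<^bsub>BijGroup V\<^esub> \<tau> \<in> A"
      by (auto simp: A_def BijGroup_def compose_Bij compose_eq inV)
  qed
  thus ?thesis unfolding aut_group_def A_def[symmetric]
    by (rule G.subgroup_imp_group)
qed

lemma translation:
  assumes "\<gamma> \<in> \<Gamma>"
  shows "\<gamma> \<in> Bij V" and "u \<in> V \<Longrightarrow> \<gamma> u \<in> V" and "inj_on \<gamma> V"
    and "u \<in> V \<Longrightarrow> v \<in> V \<Longrightarrow> adj (\<gamma> u) (\<gamma> v) \<longleftrightarrow> adj u v"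
    and "u \<in> V \<Longrightarrow> v \<in> V \<Longrightarrow> h (\<gamma> v) - h (\<gamma> u) = h v - h u"
proof -
  have \<gamma>: "\<gamma> \<in> carrier (aut_group V adj)"
    using subgroup_\<Gamma> assms by (auto simp: subgroup_def)
  thus bij: "\<gamma> \<in> Bij V" by (simp add: aut_group_def)
  show "u \<in> V \<Longrightarrow> \<gamma> u \<in> V" using Bij_imp_funcset[OF bij] by auto
  show "inj_on \<gamma> V" using bij by (simp add: Bij_def bij_betw_def)
  show "u \<in> V \<Longrightarrow> v \<in> V \<Longrightarrow> adj (\<gamma> u) (\<gamma> v) \<longleftrightarrow> adj u v"
    using \<gamma> by (simp add: aut_group_def)
  show "u \<in> V \<Longrightarrow> v \<in> V \<Longrightarrow> h (\<gamma> v) - h (\<gamma> u) = h v - h u"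
    using height assms by (simp add: graph_height_function_def)
qed

text \<open>  Quasi-transitivity enters only through finiteness of the set of orbits of this relation. It turns
  every bound that is invariant under \<open>\<Gamma>\<close> and holds vertex by vertex into a uniform one
  (\<open>uniform_bound\<close> below).\<close>

definition same_orbit :: "'a \<Rightarrow> 'a \<Rightarrow> bool" where
  "same_orbit x y \<longleftrightarrow> (\<exists>\<gamma>\<in>\<Gamma>. \<gamma> x = y)"

lemma same_orbit_V: "same_orbit x y \<Longrightarrow> x \<in> V \<Longrightarrow> y \<in> V"
  using translation(2) by (auto simp: same_orbit_def)

lemma same_orbit_refl: "x \<in> V \<Longrightarrow> same_orbit x x"
proof -
  assume x: "x \<in> V"
  have "\<one>\<^bsub>aut_group V adj\<^esub> \<in> \<Gamma>" using subgroup_\<Gamma> by (rule subgroup.one_closed)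
  hence "(\<lambda>x\<in>V. x) \<in> \<Gamma>" by (simp add: aut_group_def BijGroup_def)
  moreover have "(\<lambda>x\<in>V. x) x = x" using x by simp
  ultimately show ?thesis unfolding same_orbit_def by (intro bexI[of _ "\<lambda>x\<in>V. x"])
qed

lemma mult_\<Gamma>:
  assumes "\<gamma> \<in> \<Gamma>" "\<delta> \<in> \<Gamma>"
  shows "\<gamma> \<otimes>\<^bsub>aut_group V adj\<^esub> \<delta> = compose V \<gamma> \<delta>"
  using translation(1)[OF assms(1)] translation(1)[OF assms(2)]
  by (simp add: aut_group_def BijGroup_def)

lemma same_orbit_trans: "same_orbit x y \<Longrightarrow> same_orbit y z \<Longrightarrow> x \<in> V \<Longrightarrow> same_orbit x z"
proof -
  assume "same_orbit x y" "same_orbit y z" and x: "x \<in> V"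
  then obtain \<gamma> \<delta> where *: "\<gamma> \<in> \<Gamma>" "\<delta> \<in> \<Gamma>" "\<delta> (\<gamma> x) = z" by (auto simp: same_orbit_def)
  have "compose V \<delta> \<gamma> \<in> \<Gamma>"
    using subgroup.m_closed[OF subgroup_\<Gamma> *(2,1)] by (simp add: mult_\<Gamma> *)
  moreover have "compose V \<delta> \<gamma> x = z" using x * by (simp add: compose_eq)
  ultimately show ?thesis by (auto simp: same_orbit_def)
qed

lemma same_orbit_sym: "same_orbit x y \<Longrightarrow> x \<in> V \<Longrightarrow> same_orbit y x"
proof -
  assume "same_orbit x y" and x: "x \<in> V"
  then obtain \<gamma> where \<gamma>: "\<gamma> \<in> \<Gamma>" "\<gamma> x = y" by (auto simp: same_orbit_def)
  let ?G = "aut_group V adj"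
  have inv: "inv\<^bsub>?G\<^esub> \<gamma> \<in> \<Gamma>" using subgroup.m_inv_closed[OF subgroup_\<Gamma> \<gamma>(1)] .
  have "inv\<^bsub>?G\<^esub> \<gamma> \<otimes>\<^bsub>?G\<^esub> \<gamma> = \<one>\<^bsub>?G\<^esub>"
    using group.l_inv[OF group_aut] subgroup.mem_carrier[OF subgroup_\<Gamma> \<gamma>(1)] by blast
  hence "compose V (inv\<^bsub>?G\<^esub> \<gamma>) \<gamma> = (\<lambda>x\<in>V. x)"
    using mult_\<Gamma>[OF inv \<gamma>(1)] by (simp add: aut_group_def BijGroup_def)
  hence "(inv\<^bsub>?G\<^esub> \<gamma>) y = x" using x \<gamma> by (metis compose_eq restrict_apply')
  thus ?thesis using inv by (auto simp: same_orbit_def)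
qed

lemma finite_representatives: "\<exists>R. finite R \<and> R \<subseteq> V \<and> (\<forall>v\<in>V. \<exists>r\<in>R. same_orbit r v)"
proof -
  define orb where "orb x = {y. same_orbit x y}" for x
  have "orbits ((BijGroup V)\<lparr>carrier := \<Gamma>\<rparr>) V (\<lambda>\<gamma>. \<gamma>) = orb ` V"
    by (auto simp: orbits_def orbit_def orb_def same_orbit_def)
  hence fin: "finite (orb ` V)"
    using height by (simp add: graph_height_function_def acts_quasi_transitively_def)
  then obtain R where R: "R \<subseteq> V" "finite R" "orb ` V = orb ` R"
    using finite_subset_image[OF fin order_refl] by auto
  have "\<exists>r\<in>R. same_orbit r v" if "v \<in> V" for v
  proof -
    have "orb v \<in> orb ` V" using that by (rule imageI)
    hence "orb v \<in> orb ` R" unfolding R(3) .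
    then obtain r where "r \<in> R" "orb v = orb r" by (rule imageE)
    moreover have "v \<in> orb v" using same_orbit_refl[OF that] by (simp add: orb_def)
    ultimately show ?thesis by (auto simp: orb_def)
  qed
  thus ?thesis using R by blast
qed

lemma uniform_bound:
  fixes Q :: "'a \<Rightarrow> nat \<Rightarrow> bool"
  assumes ex: "\<And>v. v \<in> V \<Longrightarrow> \<exists>N. Q v N"
    and mono: "\<And>v N N'. Q v N \<Longrightarrow> N \<le> N' \<Longrightarrow> Q v N'"
    and orbit: "\<And>v w N. v \<in> V \<Longrightarrow> same_orbit v w \<Longrightarrow> Q v N \<Longrightarrow> Q w N"
  shows "\<exists>N. \<forall>v\<in>V. Q v N"
proof -
  obtain R where R: "finite R" "R \<subseteq> V" "\<forall>v\<in>V. \<exists>r\<in>R. same_orbit r v"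
    using finite_representatives by blast
  have "\<forall>v\<in>V. \<exists>N. Q v N" using ex by blast
  then obtain f where f: "\<forall>v\<in>V. Q v (f v)" by (rule bchoice[THEN exE])
  define N where "N = Max (f ` R)"
  have "Q v N" if v: "v \<in> V" for v
  proof -
    obtain r where r: "r \<in> R" "same_orbit r v" using R v by blast
    have "f r \<le> N" unfolding N_def using R r by simp
    hence "Q r N" using mono[of r "f r" N] f R(2) r(1) by auto
    thus ?thesis using orbit[of r v N] R(2) r by auto
  qed
  thus ?thesis by blast
qed

lemma degree_bound: "\<exists>D. \<forall>v\<in>V. finite {u\<in>V. adj v u} \<and> card {u\<in>V. adj v u} \<le> D"
proof -
  have fin: "finite {u\<in>V. adj v u}" if "v \<in> V" for v
    using loc_finite that by (simp add: locally_finite_graph_def)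
  have "\<exists>D. \<forall>v\<in>V. card {u\<in>V. adj v u} \<le> D"
  proof (rule uniform_bound)
    fix v w D assume v: "v \<in> V" and vw: "same_orbit v w" and D: "card {u\<in>V. adj v u} \<le> D"
    obtain \<gamma> where \<gamma>: "\<gamma> \<in> \<Gamma>" "\<gamma> w = v"
      using same_orbit_sym[OF vw v] by (auto simp: same_orbit_def)
    have w: "w \<in> V" using same_orbit_V[OF vw v] .
    have "card {u\<in>V. adj w u} \<le> card {u\<in>V. adj v u}"
    proof (rule card_inj_on_le[of \<gamma>])
      show "inj_on \<gamma> {u\<in>V. adj w u}" using translation(3)[OF \<gamma>(1)] by (rule inj_on_subset) auto
      show "\<gamma> ` {u\<in>V. adj w u} \<subseteq> {u\<in>V. adj v u}"
        using translation[OF \<gamma>(1)] w \<gamma>(2) by auto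
    qed (rule fin[OF v])
    thus "card {u\<in>V. adj w u} \<le> D" using D by simp
  qed auto
  thus ?thesis using fin by blast
qed

lemma height_step_bound: "\<exists>d. \<forall>u v. adj u v \<longrightarrow> \<bar>h v - h u\<bar> \<le> int d"
proof -
  have "\<exists>d. \<forall>v\<in>V. \<forall>u. adj v u \<longrightarrow> \<bar>h u - h v\<bar> \<le> int d"
  proof (rule uniform_bound)
    fix v assume v: "v \<in> V"
    have fin: "finite {u\<in>V. adj v u}"
      using loc_finite v by (simp add: locally_finite_graph_def)
    show "\<exists>d. \<forall>u. adj v u \<longrightarrow> \<bar>h u - h v\<bar> \<le> int d"
    proof (intro exI allI impI)
      fix u assume "adj v u"
      hence "nat \<bar>h u - h v\<bar> \<le> Max ((\<lambda>u. nat \<bar>h u - h v\<bar>) ` {u\<in>V. adj v u})"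
        using fin adj_V by (intro Max_ge) auto
      thus "\<bar>h u - h v\<bar> \<le> int (Max ((\<lambda>u. nat \<bar>h u - h v\<bar>) ` {u\<in>V. adj v u}))"
        by linarith
    qed
  next
    fix v w d
    assume v: "v \<in> V" and vw: "same_orbit v w" and d: "\<forall>u. adj v u \<longrightarrow> \<bar>h u - h v\<bar> \<le> int d"
    have w: "w \<in> V" using same_orbit_V[OF vw v] .
    obtain \<gamma> where \<gamma>: "\<gamma> \<in> \<Gamma>" "\<gamma> w = v"
      using same_orbit_sym[OF vw v] by (auto simp: same_orbit_def)
    show "\<forall>u. adj w u \<longrightarrow> \<bar>h u - h w\<bar> \<le> int d"
    proof (intro allI impI)
      fix u assume u: "adj w u"
      hence "adj v (\<gamma> u)" using translation(4)[OF \<gamma>(1) w, of u] \<gamma>(2) adj_V by blast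
      hence "\<bar>h (\<gamma> u) - h (\<gamma> w)\<bar> \<le> int d" using d \<gamma>(2) by simp
      thus "\<bar>h u - h w\<bar> \<le> int d" using translation(5)[OF \<gamma>(1) w, of u] adj_V(2)[OF u] by simp
    qed
  next
    fix v d d'
    assume "\<forall>u. adj v u \<longrightarrow> \<bar>h u - h v\<bar> \<le> int d" "d \<le> d'"
    thus "\<forall>u. adj v u \<longrightarrow> \<bar>h u - h v\<bar> \<le> int d'" by (meson of_nat_mono order_trans)
  qed
  thus ?thesis using adj_V by blast
qed

section \<open>Walks and their counts\<close>

lemma walks_0: "v \<in> V \<Longrightarrow> walks V adj 0 v = {[v]}"
  by (auto simp: walks_def length_Suc_conv)

lemma walk_nth_V: "p \<in> walks V adj n v \<Longrightarrow> i \<le> n \<Longrightarrow> p ! i \<in> V"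
  by (auto simp: walks_def subset_iff)

lemma finite_card_walks:
  assumes D: "\<forall>v\<in>V. finite {u\<in>V. adj v u} \<and> card {u\<in>V. adj v u} \<le> D" and "v \<in> V"
  shows "finite (walks V adj n v) \<and> card (walks V adj n v) \<le> D ^ n"
  using assms(2)
proof (induction n arbitrary: v)
  case 0 thus ?case by (simp add: walks_0)
next
  case (Suc n)
  let ?N = "{u\<in>V. adj v u}"
  have N: "finite ?N" "card ?N \<le> D" using D Suc.prems by auto
  have sub: "walks V adj (Suc n) v \<subseteq> (\<Union>u\<in>?N. (#) v ` walks V adj n u)"
  proof
    fix p assume p: "p \<in> walks V adj (Suc n) v"
    then obtain q where q: "p = v # q" "length q = Suc n"
      by (auto simp: walks_def length_Suc_conv)
    have adj: "adj (p ! i) (p ! (i + 1))" if "i < Suc n" for i using p that by (simp add: walks_def)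
    have "adj v (q ! 0)" using adj[of 0] q by simp
    moreover have "adj (q ! i) (q ! (i + 1))" if "i < n" for i using adj[of "Suc i"] q that by simp
    ultimately have "q \<in> walks V adj n (q ! 0)" "q ! 0 \<in> ?N"
      using p q adj_V by (auto simp: walks_def)
    thus "p \<in> (\<Union>u\<in>?N. (#) v ` walks V adj n u)" using q by blast
  qed
  have fin: "finite (\<Union>u\<in>?N. (#) v ` walks V adj n u)" using N Suc.IH by auto
  have "card (walks V adj (Suc n) v) \<le> card (\<Union>u\<in>?N. (#) v ` walks V adj n u)"
    using sub fin by (rule card_mono[rotated])
  also have "\<dots> \<le> (\<Sum>u\<in>?N. card ((#) v ` walks V adj n u))" using N by (intro card_UN_le)
  also have "\<dots> \<le> (\<Sum>u\<in>?N. D ^ n)"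
    using Suc.IH by (intro sum_mono) (auto intro: order_trans[OF card_image_le])
  also have "\<dots> \<le> D * D ^ n" using N by simp
  finally show ?case using finite_subset[OF sub fin] by simp
qed

lemma finite_walks: "v \<in> V \<Longrightarrow> finite (walks V adj n v)"
proof -
  assume v: "v \<in> V"
  obtain D where "\<forall>v\<in>V. finite {u\<in>V. adj v u} \<and> card {u\<in>V. adj v u} \<le> D"
    using degree_bound by blast
  from finite_card_walks[OF this v] show ?thesis by simp
qed

lemma finite_saws: "v \<in> V \<Longrightarrow> finite (saws V adj n v)"
  using finite_walks by (rule finite_subset[rotated]) (auto simp: saws_def)

lemma finite_bridges: "v \<in> V \<Longrightarrow> finite (bridges V adj h n v)"
  using finite_saws by (rule finite_subset[rotated]) (auto simp: bridges_def)

lemma saw_take_drop: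
  assumes "p \<in> saws V adj n v" "j \<le> n"
  shows "take (Suc j) p \<in> saws V adj j v" and "drop j p \<in> saws V adj (n - j) (p ! j)"
  using assms by (auto simp: saws_def walks_def dest: in_set_takeD in_set_dropD)

lemma walk_append_nth:
  assumes "p \<in> walks V adj m v" "q \<in> walks V adj n (p ! m)" "i \<le> m + n"
  shows "(p @ tl q) ! i = (if i \<le> m then p ! i else q ! (i - m))"
  using assms by (auto simp: walks_def nth_append nth_tl Suc_diff_Suc not_le less_Suc_eq_le)

lemma walk_append:
  assumes "p \<in> walks V adj m v" "q \<in> walks V adj n (p ! m)"
  shows "p @ tl q \<in> walks V adj (m + n) v"
proof -
  have len: "length p = m + 1" "length q = n + 1" using assms by (auto simp: walks_def)
  have set: "set (tl q) \<subseteq> set q" by (cases q) auto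
  have "adj ((p @ tl q) ! i) ((p @ tl q) ! (i + 1))" if i: "i < m + n" for i
  proof (cases "i < m")
    case True
    thus ?thesis using assms(1) walk_append_nth[OF assms, of i] walk_append_nth[OF assms, of "i + 1"]
      by (simp add: walks_def)
  next
    case False
    have "adj (q ! (i - m)) (q ! (i - m + 1))" using assms(2) i False by (simp add: walks_def)
    moreover have "(p @ tl q) ! i = q ! (i - m)"
      using walk_append_nth[OF assms, of i] i False assms(2) by (auto simp: walks_def)
    moreover have "(p @ tl q) ! (i + 1) = q ! (i - m + 1)"
      using walk_append_nth[OF assms, of "i + 1"] i False by (simp add: Suc_diff_le)
    ultimately show ?thesis by simp
  qed
  thus ?thesis using assms set len by (auto simp: walks_def nth_append)
qed

lemma walk_map:
  assumes "p \<in> walks V adj n v" "\<gamma> \<in> \<Gamma>"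
  shows "map \<gamma> p \<in> walks V adj n (\<gamma> v)"
  using assms translation[OF assms(2)] walk_nth_V[OF assms(1)] by (auto simp: walks_def)

lemma saw_map:
  assumes "p \<in> saws V adj n v" "\<gamma> \<in> \<Gamma>"
  shows "map \<gamma> p \<in> saws V adj n (\<gamma> v)"
proof -
  have p: "p \<in> walks V adj n v" "distinct p" using assms by (auto simp: saws_def)
  have "inj_on \<gamma> (set p)"
    using translation(3)[OF assms(2)] p(1) by (auto simp: walks_def intro: inj_on_subset)
  thus ?thesis using walk_map[OF p(1) assms(2)] p(2) by (simp add: saws_def distinct_map)
qed

lemma bridge_map:
  assumes "p \<in> bridges V adj h n v" "\<gamma> \<in> \<Gamma>" "v \<in> V"
  shows "map \<gamma> p \<in> bridges V adj h n (\<gamma> v)"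
proof -
  have p: "p \<in> saws V adj n v" "p \<in> walks V adj n v" using assms by (auto simp: bridges_def saws_def)
  have len: "length p = n + 1" using p by (simp add: walks_def)
  have "h (\<gamma> v) < h (\<gamma> (p ! i)) \<and> h (\<gamma> (p ! i)) \<le> h (\<gamma> (p ! n))" if "i \<in> {1..n}" for i
  proof -
    have "h v < h (p ! i)" "h (p ! i) \<le> h (p ! n)" using assms(1) that by (auto simp: bridges_def)
    moreover have "h (\<gamma> (p ! i)) - h (\<gamma> v) = h (p ! i) - h v"
      using translation(5)[OF assms(2,3)] walk_nth_V[OF p(2)] that by simp
    moreover have "h (\<gamma> (p ! n)) - h (\<gamma> v) = h (p ! n) - h v"
      using translation(5)[OF assms(2,3)] walk_nth_V[OF p(2)] by simp
    ultimately show ?thesis by linarith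
  qed
  thus ?thesis using saw_map[OF p(1) assms(2)] len by (simp add: bridges_def)
qed

lemma inj_on_map_walks: "\<gamma> \<in> \<Gamma> \<Longrightarrow> inj_on (map \<gamma>) (walks V adj n v)"
proof -
  assume \<gamma>: "\<gamma> \<in> \<Gamma>"
  have "walks V adj n v \<subseteq> lists V" by (auto simp: walks_def)
  moreover have "inj_on (map \<gamma>) (lists V)" using translation(3)[OF \<gamma>] by (rule inj_on_map_lists)
  ultimately show ?thesis by (rule inj_on_subset[rotated])
qed

lemma card_saws_orbit_le:
  assumes "same_orbit v w" "v \<in> V"
  shows "card (saws V adj n v) \<le> card (saws V adj n w)"
proof -
  obtain \<gamma> where \<gamma>: "\<gamma> \<in> \<Gamma>" "\<gamma> v = w" using assms by (auto simp: same_orbit_def)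
  have "inj_on (map \<gamma>) (saws V adj n v)"
    using inj_on_map_walks[OF \<gamma>(1)] by (rule inj_on_subset) (auto simp: saws_def)
  thus ?thesis using saw_map \<gamma> finite_saws[OF same_orbit_V[OF assms]]
    by (intro card_inj_on_le[of "map \<gamma>"]) auto
qed

lemma card_bridges_orbit_le:
  assumes "same_orbit v w" "v \<in> V"
  shows "card (bridges V adj h n v) \<le> card (bridges V adj h n w)"
proof -
  obtain \<gamma> where \<gamma>: "\<gamma> \<in> \<Gamma>" "\<gamma> v = w" using assms by (auto simp: same_orbit_def)
  have "inj_on (map \<gamma>) (bridges V adj h n v)"
    using inj_on_map_walks[OF \<gamma>(1)] by (rule inj_on_subset) (auto simp: saws_def bridges_def)
  thus ?thesis using bridge_map \<gamma> assms(2) finite_bridges[OF same_orbit_V[OF assms]]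
    by (intro card_inj_on_le[of "map \<gamma>"]) auto
qed

text \<open>  This makes the maxima and minima over all vertices that define the counts genuine ones: \<open>Max\<close> and \<open>Min\<close>
  are meaningful only on finite sets.\<close>

lemma finite_orbit_function_image:
  fixes f :: "'a \<Rightarrow> nat"
  assumes "\<And>v w. same_orbit v w \<Longrightarrow> v \<in> V \<Longrightarrow> f v \<le> f w"
  shows "finite (f ` V)"
proof -
  have "\<exists>N. \<forall>v\<in>V. f v \<le> N"
  proof (rule uniform_bound)
    fix v w N assume "v \<in> V" "same_orbit v w" "f v \<le> N"
    thus "f w \<le> N" using assms[OF same_orbit_sym] same_orbit_V by (meson order_trans)
  qed auto
  then obtain N where "\<forall>v\<in>V. f v \<le> N" by blast
  hence "f ` V \<subseteq> {..N}" by auto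
  thus ?thesis by (rule finite_subset) simp
qed

lemma max_saws_attained: "\<exists>v\<in>V. max_saws V adj n = card (saws V adj n v)"
proof -
  have "max_saws V adj n \<in> (\<lambda>v. card (saws V adj n v)) ` V"
    unfolding max_saws_def using card_saws_orbit_le nonempty
    by (intro Max_in finite_orbit_function_image) auto
  thus ?thesis by auto
qed

lemma max_saws_ge: "v \<in> V \<Longrightarrow> card (saws V adj n v) \<le> max_saws V adj n"
  unfolding max_saws_def using card_saws_orbit_le
  by (intro Max_ge finite_orbit_function_image) auto

lemma min_bridges_attained: "\<exists>v\<in>V. min_bridges V adj h n = card (bridges V adj h n v)"
proof -
  have "min_bridges V adj h n \<in> (\<lambda>v. card (bridges V adj h n v)) ` V"
    unfolding min_bridges_def using card_bridges_orbit_le nonempty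
    by (intro Min_in finite_orbit_function_image) auto
  thus ?thesis by auto
qed

lemma min_bridges_le: "v \<in> V \<Longrightarrow> min_bridges V adj h n \<le> card (bridges V adj h n v)"
  unfolding min_bridges_def using card_bridges_orbit_le
  by (intro Min_le finite_orbit_function_image) auto

lemma min_bridges_le_max_saws: "min_bridges V adj h n \<le> max_saws V adj n"
proof -
  obtain v where v: "v \<in> V" using nonempty by blast
  have "card (bridges V adj h n v) \<le> card (saws V adj n v)"
    using finite_saws[OF v] by (intro card_mono) (auto simp: bridges_def)
  thus ?thesis using min_bridges_le[OF v, of n] max_saws_ge[OF v, of n] by simp
qed

lemma exists_higher: "v \<in> V \<Longrightarrow> \<exists>w\<in>V. adj v w \<and> h v < h w"
  and exists_lower: "v \<in> V \<Longrightarrow> \<exists>u\<in>V. adj v u \<and> h u < h v"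
  using height unfolding graph_height_function_def by blast+

section \<open>Concatenation of bridges\<close>

text \<open>  The second bridge stays strictly above the end of the first, and the first does not exceed its own end.
  So they meet only in the common vertex.\<close>

lemma bridge_append:
  assumes p: "p \<in> bridges V adj h m v" and q: "q \<in> bridges V adj h n (p ! m)"
  shows "p @ tl q \<in> bridges V adj h (m + n) v"
proof -
  have pw: "p \<in> walks V adj m v" and qw: "q \<in> walks V adj n (p ! m)"
    and dist: "distinct p" "distinct q"
    using p q by (auto simp: bridges_def saws_def)
  have len: "length p = Suc m" "length q = Suc n" "p ! 0 = v" "q ! 0 = p ! m"
    using pw qw by (auto simp: walks_def)
  have pm: "h (p ! i) \<le> h (p ! m)" if "i \<le> m" for i
  proof (cases "i = 0")
    case True thus ?thesis using p len by (cases "m = 0") (auto simp: bridges_def intro: less_imp_le)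
  next
    case False thus ?thesis using p that by (auto simp: bridges_def)
  qed
  have qn: "h (p ! m) < h (q ! i) \<and> h (q ! i) \<le> h (q ! n)" if "0 < i" "i \<le> n" for i
    using q that by (auto simp: bridges_def)
  have "x \<notin> set (tl q)" if "x \<in> set p" for x
  proof
    assume "x \<in> set (tl q)"
    then obtain i where "i < n" "x = q ! Suc i"
      using len by (auto simp: in_set_conv_nth nth_tl)
    hence "h (p ! m) < h x" using qn[of "Suc i"] by auto
    moreover have "h x \<le> h (p ! m)" using that pm len by (auto simp: in_set_conv_nth)
    ultimately show False by simp
  qed
  hence saw: "p @ tl q \<in> saws V adj (m + n) v"
    using walk_append[OF pw qw] dist by (auto simp: saws_def distinct_tl)
  have nth: "(p @ tl q) ! i = (if i \<le> m then p ! i else q ! (i - m))" if "i \<le> m + n" for i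
    using walk_append_nth[OF pw qw that] .
  have last: "(p @ tl q) ! (m + n) = q ! n" using nth[of "m + n"] len by auto
  have mn: "h (p ! m) \<le> h (q ! n)" using qn[of n] len by (cases "n = 0") auto
  have vm: "h v \<le> h (p ! m)" using pm[of 0] len by simp
  have "h v < h ((p @ tl q) ! i) \<and> h ((p @ tl q) ! i) \<le> h (q ! n)" if i: "i \<in> {1..m + n}" for i
  proof (cases "i \<le> m")
    case True
    have "h v < h (p ! i)" using p i True by (auto simp: bridges_def)
    thus ?thesis using nth[of i] True i pm[OF True] mn by auto
  next
    case False
    hence "h (p ! m) < h (q ! (i - m)) \<and> h (q ! (i - m)) \<le> h (q ! n)"
      using i by (intro qn) auto
    thus ?thesis using nth[of i] False i vm by auto
  qed
  thus ?thesis using saw last by (simp add: bridges_def)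
qed

lemma bridge_end_V: "p \<in> bridges V adj h m v \<Longrightarrow> p ! m \<in> V"
  using walk_nth_V by (auto simp: bridges_def saws_def)

lemma sum_card_bridges_le:
  assumes "v \<in> V"
  shows "(\<Sum>p\<in>bridges V adj h m v. card (bridges V adj h n (p ! m))) \<le> card (bridges V adj h (m + n) v)"
proof -
  let ?S = "SIGMA p:bridges V adj h m v. bridges V adj h n (p ! m)"
  let ?f = "\<lambda>(p, q). p @ tl q"
  have len: "length p = Suc m" "length q = Suc n" "q ! 0 = p ! m" if "(p, q) \<in> ?S" for p q
    using that by (auto simp: bridges_def saws_def walks_def)
  have "inj_on ?f ?S"
  proof (rule inj_onI)
    fix x y assume x: "x \<in> ?S" and y: "y \<in> ?S" and eq: "?f x = ?f y"
    obtain p q p' q' where xy: "x = (p, q)" "y = (p', q')" by (metis surj_pair)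
    have L: "length p = length p'" "length q = Suc n" "length q' = Suc n" "q ! 0 = p ! m" "q' ! 0 = p' ! m"
      using len x y unfolding xy by metis+
    have pp: "p = p'" and "tl q = tl q'" using eq L(1) by (auto simp: xy)
    moreover have "q \<noteq> []" "q' \<noteq> []" using L by auto
    moreover have "hd q = hd q'" using L pp \<open>q \<noteq> []\<close> \<open>q' \<noteq> []\<close> by (simp add: hd_conv_nth)
    ultimately show "x = y" unfolding xy by (metis list.expand)
  qed
  moreover have "?f ` ?S \<subseteq> bridges V adj h (m + n) v" using bridge_append by auto
  ultimately have "card ?S \<le> card (bridges V adj h (m + n) v)"
    using finite_bridges[OF assms] by (intro card_inj_on_le)
  thus ?thesis using finite_bridges[OF assms] finite_bridges[OF bridge_end_V]
    by (subst (asm) card_SigmaI) auto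
qed

lemma card_bridges_pos: "v \<in> V \<Longrightarrow> 1 \<le> card (bridges V adj h n v)"
proof (induction n arbitrary: v)
  case 0
  have "bridges V adj h 0 v = {[v]}" unfolding bridges_def saws_def walks_0[OF 0] by auto
  thus ?case by simp
next
  case (Suc n)
  obtain w where w: "w \<in> V" "adj v w" "h v < h w" using exists_higher[OF Suc.prems] by blast
  have "[v, w] \<in> bridges V adj h 1 v"
    using w Suc.prems by (auto simp: bridges_def saws_def walks_def)
  hence "card (bridges V adj h n ([v, w] ! 1)) \<le> (\<Sum>p\<in>bridges V adj h 1 v. card (bridges V adj h n (p ! 1)))"
    using finite_bridges[OF Suc.prems] by (intro member_le_sum) auto
  also have "\<dots> \<le> card (bridges V adj h (Suc n) v)" using sum_card_bridges_le[OF Suc.prems, of n 1] by simp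
  finally show ?case using Suc.IH[OF w(1)] by simp
qed

lemma min_bridges_pos: "1 \<le> min_bridges V adj h n"
  using min_bridges_attained[of n] card_bridges_pos[of _ n] by auto

lemma card_bridges_mult_min_bridges_le:
  assumes "v \<in> V"
  shows "card (bridges V adj h m v) * min_bridges V adj h n \<le> card (bridges V adj h (m + n) v)"
proof -
  have "card (bridges V adj h m v) * min_bridges V adj h n \<le>
      (\<Sum>p\<in>bridges V adj h m v. card (bridges V adj h n (p ! m)))"
    using sum_mono[of "bridges V adj h m v" "\<lambda>_. min_bridges V adj h n"
      "\<lambda>p. card (bridges V adj h n (p ! m))"] min_bridges_le bridge_end_V by simp
  thus ?thesis using sum_card_bridges_le[OF assms] by (rule order_trans)
qed

lemma min_bridges_supermultiplicative:
  "min_bridges V adj h m * min_bridges V adj h n \<le> min_bridges V adj h (m + n)"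
proof -
  obtain v where v: "v \<in> V" "min_bridges V adj h (m + n) = card (bridges V adj h (m + n) v)"
    using min_bridges_attained by blast
  have "min_bridges V adj h m * min_bridges V adj h n \<le> card (bridges V adj h m v) * min_bridges V adj h n"
    using min_bridges_le[OF v(1)] by (intro mult_right_mono) auto
  also have "\<dots> \<le> card (bridges V adj h (m + n) v)"
    using v(1) by (rule card_bridges_mult_min_bridges_le)
  finally show ?thesis using v(2) by simp
qed

lemma max_saws_bound: "\<exists>D. \<forall>n. max_saws V adj n \<le> D ^ n"
proof -
  obtain D where D: "\<forall>v\<in>V. finite {u\<in>V. adj v u} \<and> card {u\<in>V. adj v u} \<le> D"
    using degree_bound by blast
  have "max_saws V adj n \<le> D ^ n" for n
  proof -
    obtain v where v: "v \<in> V" "max_saws V adj n = card (saws V adj n v)"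
      using max_saws_attained by blast
    have "card (saws V adj n v) \<le> card (walks V adj n v)"
      using finite_walks[OF v(1)] by (intro card_mono) (auto simp: saws_def)
    thus ?thesis using finite_card_walks[OF D v(1), of n] v(2) by simp
  qed
  thus ?thesis by blast
qed

section \<open>Bridges from different vertices\<close>

text \<open>  Paths are handled as reachability here, since only the heights they visit matter. The bounds apply to the
  target of a step, as in the definition of a bridge, where the first vertex is exempt from the strict
  inequality.\<close>

abbreviation confined :: "int \<Rightarrow> int \<Rightarrow> 'a \<Rightarrow> 'a \<Rightarrow> bool" where
  "confined lo hi a b \<equiv> adj a b \<and> lo \<le> h b \<and> h b \<le> hi"

lemma confined_mono:
  "(confined lo hi)\<^sup>*\<^sup>* x y \<Longrightarrow> lo' \<le> lo \<Longrightarrow> hi \<le> hi' \<Longrightarrow> (confined lo' hi')\<^sup>*\<^sup>* x y"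
  by (erule rtranclp_mono[THEN predicate2D, rotated]) auto

lemma confined_V: "(confined lo hi)\<^sup>*\<^sup>* x y \<Longrightarrow> x \<in> V \<Longrightarrow> y \<in> V"
  by (induction rule: rtranclp_induct) (auto intro: adj_V)

lemma confined_map:
  assumes "(confined lo hi)\<^sup>*\<^sup>* x y" "x \<in> V" "\<gamma> \<in> \<Gamma>"
  shows "(confined (lo + (h (\<gamma> x) - h x)) (hi + (h (\<gamma> x) - h x)))\<^sup>*\<^sup>* (\<gamma> x) (\<gamma> y)"
  using assms(1)
proof (induction rule: rtranclp_induct)
  case (step y z)
  have yz: "y \<in> V" "z \<in> V" using step.hyps(2) adj_V by blast+
  have "adj (\<gamma> y) (\<gamma> z)" using translation(4)[OF assms(3) yz] step.hyps(2) by simp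
  moreover have "h (\<gamma> z) - h (\<gamma> x) = h z - h x" using translation(5)[OF assms(3,2) yz(2)] .
  ultimately have "confined (lo + (h (\<gamma> x) - h x)) (hi + (h (\<gamma> x) - h x)) (\<gamma> y) (\<gamma> z)"
    using step.hyps(2) by auto
  with step.IH show ?case by (rule rtranclp.rtrancl_into_rtrancl)
qed simp

lemma confined_path_exists:
  assumes "x \<in> V" "y \<in> V"
  shows "\<exists>N. (confined (h x - int N) (h x + int N))\<^sup>*\<^sup>* x y"
proof -
  obtain n p where p: "p \<in> walks V adj n x" "p ! n = y"
    using connected assms unfolding connected_graph_def by blast
  have "\<exists>N. (confined (h x - int N) (h x + int N))\<^sup>*\<^sup>* x (p ! i)" if "i \<le> n" for i
    using that
  proof (induction i)
    case 0
    have "p ! 0 = x" using p by (simp add: walks_def)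
    thus ?case by auto
  next
    case (Suc i)
    then obtain N where N: "(confined (h x - int N) (h x + int N))\<^sup>*\<^sup>* x (p ! i)" by auto
    define N' where "N' = max N (nat \<bar>h (p ! Suc i) - h x\<bar>)"
    have "(confined (h x - int N') (h x + int N'))\<^sup>*\<^sup>* x (p ! i)"
      using N by (rule confined_mono) (auto simp: N'_def)
    moreover have "confined (h x - int N') (h x + int N') (p ! i) (p ! Suc i)"
      using p(1) Suc.prems by (auto simp: N'_def walks_def)
    ultimately have "(confined (h x - int N') (h x + int N'))\<^sup>*\<^sup>* x (p ! Suc i)"
      by (rule rtranclp.rtrancl_into_rtrancl)
    thus ?case by blast
  qed
  from this[of n] p(2) show ?thesis by simp
qed

text \<open>  In \<open>linking_bridge\<close> the two endpoints to be connected depend on \<open>N\<close>, so it is essential that one \<open>N\<close>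
  serves all pairs of vertices.\<close>

lemma confined_path_uniform:
  "\<exists>N. \<forall>x\<in>V. \<forall>y\<in>V. \<exists>y'. same_orbit y y' \<and> (confined (h x - int N) (h x + int N))\<^sup>*\<^sup>* x y'"
proof -
  let ?Q = "\<lambda>x y N. \<exists>y'. same_orbit y y' \<and> (confined (h x - int N) (h x + int N))\<^sup>*\<^sup>* x y'"
  have mono: "?Q x y N'" if "?Q x y N" "N \<le> N'" for x y N N'
    using that confined_mono[of "h x - int N" "h x + int N" x _ "h x - int N'" "h x + int N'"] by auto
  have "\<exists>N. \<forall>x\<in>V. ?Q x y N" if y: "y \<in> V" for y
  proof (rule uniform_bound)
    show "\<exists>N. ?Q x y N" if "x \<in> V" for x
      using confined_path_exists[OF that y] same_orbit_refl[OF y] by blast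
  next
    fix x z N assume x: "x \<in> V" and xz: "same_orbit x z" and Q: "?Q x y N"
    obtain \<gamma> where \<gamma>: "\<gamma> \<in> \<Gamma>" "\<gamma> x = z" using xz by (auto simp: same_orbit_def)
    obtain y' where y': "same_orbit y y'" "(confined (h x - int N) (h x + int N))\<^sup>*\<^sup>* x y'"
      using Q by blast
    have "same_orbit y' (\<gamma> y')" using \<gamma>(1) by (auto simp: same_orbit_def)
    hence "same_orbit y (\<gamma> y')" using same_orbit_trans[OF y'(1) _ y] by blast
    moreover have "(confined (h z - int N) (h z + int N))\<^sup>*\<^sup>* z (\<gamma> y')"
      using confined_map[OF y'(2) x \<gamma>(1)] unfolding \<gamma>(2) by (simp add: add.commute)
    ultimately show "?Q z y N" by blast
  next
    show "?Q x y N'" if "?Q x y N" "N \<le> N'" for x N N' using mono[OF that] .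
  qed
  hence "\<exists>N. \<forall>y\<in>V. \<forall>x\<in>V. ?Q x y N"
  proof (rule uniform_bound)
    fix y N N' assume "\<forall>x\<in>V. ?Q x y N" "N \<le> N'"
    thus "\<forall>x\<in>V. ?Q x y N'" using mono by blast
  next
    fix y z N assume y: "y \<in> V" and yz: "same_orbit y z" and Q: "\<forall>x\<in>V. ?Q x y N"
    have "same_orbit z y'" if "same_orbit y y'" for y'
      using same_orbit_trans[OF same_orbit_sym[OF yz y] that same_orbit_V[OF yz y]] .
    thus "\<forall>x\<in>V. ?Q x z N" using Q by meson
  qed
  thus ?thesis by blast
qed

lemma ascending_path:
  assumes "v \<in> V"
  shows "\<exists>v'\<in>V. h v + int N \<le> h v' \<and> (confined (h v + 1) (h v'))\<^sup>*\<^sup>* v v'"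
proof (induction N)
  case 0 thus ?case using assms by (intro bexI[of _ v]) auto
next
  case (Suc N)
  then obtain u where u: "u \<in> V" "h v + int N \<le> h u" "(confined (h v + 1) (h u))\<^sup>*\<^sup>* v u" by blast
  obtain w where w: "w \<in> V" "adj u w" "h u < h w" using exists_higher[OF u(1)] by blast
  have "(confined (h v + 1) (h w))\<^sup>*\<^sup>* v u" using u(3) by (rule confined_mono) (use w in auto)
  moreover have "confined (h v + 1) (h w) u w" using u w by auto
  ultimately have "(confined (h v + 1) (h w))\<^sup>*\<^sup>* v w" by (rule rtranclp.rtrancl_into_rtrancl)
  thus ?case using u w by (intro bexI[of _ w]) auto
qed

lemma path_ascending_to:
  assumes "w \<in> V"
  shows "\<exists>w'\<in>V. h w' + int N \<le> h w \<and> (confined (h w') (h w))\<^sup>*\<^sup>* w' w"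
proof (induction N)
  case 0 thus ?case using assms by (intro bexI[of _ w]) auto
next
  case (Suc N)
  then obtain u where u: "u \<in> V" "h u + int N \<le> h w" "(confined (h u) (h w))\<^sup>*\<^sup>* u w" by blast
  obtain z where z: "z \<in> V" "adj u z" "h z < h u" using exists_lower[OF u(1)] by blast
  have "(confined (h z) (h w))\<^sup>*\<^sup>* u w" using u(3) by (rule confined_mono) (use z in auto)
  moreover have "confined (h z) (h w) z u" using u z adj_commute by auto
  ultimately have "(confined (h z) (h w))\<^sup>*\<^sup>* z w" by (rule converse_rtranclp_into_rtranclp[rotated])
  thus ?case using u z by (intro bexI[of _ z]) auto
qed

lemma bridge_if_confined_path:
  assumes "(confined (h v + 1) (h z))\<^sup>*\<^sup>* v z" "v \<in> V"
  shows "\<exists>n. \<exists>p\<in>bridges V adj h n v. p ! n = z"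
proof -
  obtain n p where p: "length p = Suc n" "p ! 0 = v" "p ! n = z" "distinct p"
    and steps: "\<And>i. i < n \<Longrightarrow> confined (h v + 1) (h z) (p ! i) (p ! Suc i)"
    using distinct_chain_if_rtranclp[OF assms(1)] by blast
  have "p ! i \<in> V" if "i \<le> n" for i
    using that steps[of "i - 1"] adj_V p assms(2) by (cases i) auto
  hence "set p \<subseteq> V" using p(1) by (auto simp: in_set_conv_nth)
  hence saw: "p \<in> saws V adj n v" using p steps by (auto simp: saws_def walks_def)
  have "h v < h (p ! i) \<and> h (p ! i) \<le> h (p ! n)" if "i \<in> {1..n}" for i
    using steps[of "i - 1"] that p(3) by (cases i) auto
  hence "p \<in> bridges V adj h n v" using saw by (simp add: bridges_def)
  thus ?thesis using p(3) by blast
qed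

text \<open>  A path from \<open>v\<close> to the orbit of \<open>w\<close> may leave the strip between the heights of its endpoints, but only by
  \<open>N\<close>. This is repaired by climbing from \<open>v\<close> by more than \<open>N\<close> before following the path, and by letting the path
  lead to a vertex from which one climbs by \<open>2 N\<close> to a translate of \<open>w\<close>. The factor 2 is needed because the
  path can end \<open>N\<close> below its start and can meanwhile rise \<open>N\<close> above it.\<close>

lemma linking_bridge:
  assumes "v \<in> V" "w \<in> V"
  shows "\<exists>n. \<exists>p\<in>bridges V adj h n v. same_orbit w (p ! n)"
proof -
  obtain N where N: "\<And>x y. x \<in> V \<Longrightarrow> y \<in> V \<Longrightarrow>
      \<exists>y'. same_orbit y y' \<and> (confined (h x - int N) (h x + int N))\<^sup>*\<^sup>* x y'"
    using confined_path_uniform by blast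
  obtain v' where v': "v' \<in> V" "h v + int (Suc N) \<le> h v'" "(confined (h v + 1) (h v'))\<^sup>*\<^sup>* v v'"
    using ascending_path[OF assms(1)] by blast
  obtain w' where w': "w' \<in> V" "h w' + int (2 * N) \<le> h w" "(confined (h w') (h w))\<^sup>*\<^sup>* w' w"
    using path_ascending_to[OF assms(2)] by blast
  obtain u where u: "same_orbit w' u" "(confined (h v' - int N) (h v' + int N))\<^sup>*\<^sup>* v' u"
    using N[OF v'(1) w'(1)] by blast
  obtain \<gamma> where \<gamma>: "\<gamma> \<in> \<Gamma>" "\<gamma> w' = u" using u(1) by (auto simp: same_orbit_def)
  define z where "z = \<gamma> w"
  have z: "h z = h w + (h u - h w')"
    using translation(5)[OF \<gamma>(1) w'(1) assms(2)] \<gamma>(2) by (simp add: z_def)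
  have u_low: "h v' - int N \<le> h u"
    using u(2) by (cases rule: rtranclp.cases) auto
  have "(confined (h v + 1) (h z))\<^sup>*\<^sup>* v v'"
    using v'(3) by (rule confined_mono) (use z u_low w'(2) in auto)
  also have "(confined (h v + 1) (h z))\<^sup>*\<^sup>* v' u"
    using u(2) by (rule confined_mono) (use z u_low w'(2) v'(2) in auto)
  also have "(confined (h v + 1) (h z))\<^sup>*\<^sup>* u z"
    using confined_map[OF w'(3,1) \<gamma>(1)] unfolding \<gamma>(2) z_def[symmetric]
    by (rule confined_mono) (use z u_low w'(2) v'(2) in auto)
  finally have "\<exists>n. \<exists>p\<in>bridges V adj h n v. p ! n = z"
    using assms(1) by (rule bridge_if_confined_path)
  moreover have "same_orbit w z" using \<gamma>(1) by (auto simp: same_orbit_def z_def)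
  ultimately show ?thesis by blast
qed

lemma card_bridges_mono: "v \<in> V \<Longrightarrow> m \<le> n \<Longrightarrow> card (bridges V adj h m v) \<le> card (bridges V adj h n v)"
  using card_bridges_mult_min_bridges_le[of v m "n - m"] min_bridges_pos[of "n - m"]
  by (simp add: order_trans[rotated])

text \<open>  Prefixing a linking bridge maps the bridges from the orbit of \<open>w\<close> injectively to longer bridges from
  \<open>v\<close>. Monotonicity in the length makes the added length the same for all pairs.\<close>

lemma card_bridges_compare: "\<exists>K. \<forall>w\<in>V. \<forall>v\<in>V. \<forall>n. card (bridges V adj h n w) \<le> card (bridges V adj h (n + K) v)"
proof -
  let ?Q = "\<lambda>v w K. \<forall>n. card (bridges V adj h n w) \<le> card (bridges V adj h (n + K) v)"
  have mono: "?Q v w K'" if "v \<in> V" "?Q v w K" "K \<le> K'" for v w K K'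
  proof
    fix n
    have "card (bridges V adj h n w) \<le> card (bridges V adj h (n + K) v)" using that(2) ..
    also have "\<dots> \<le> card (bridges V adj h (n + K') v)" using that by (intro card_bridges_mono) auto
    finally show "card (bridges V adj h n w) \<le> card (bridges V adj h (n + K') v)" .
  qed
  have "\<exists>K. \<forall>v\<in>V. v \<in> V \<and> ?Q v w K" if w: "w \<in> V" for w
  proof (rule uniform_bound)
    \<comment> \<open>Membership in \<open>V\<close> is part of the property, as monotonicity in \<open>K\<close> holds only for vertices.\<close>
    fix v assume v: "v \<in> V"
    obtain k p where p: "p \<in> bridges V adj h k v" "same_orbit w (p ! k)"
      using linking_bridge[OF v w] by blast
    have "card (bridges V adj h n w) \<le> card (bridges V adj h (n + k) v)" for n
    proof -
      have "card (bridges V adj h n w) \<le> card (bridges V adj h n (p ! k))"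
        using p(2) w by (rule card_bridges_orbit_le)
      also have "\<dots> \<le> (\<Sum>p\<in>bridges V adj h k v. card (bridges V adj h n (p ! k)))"
        using p(1) finite_bridges[OF v] by (intro member_le_sum) auto
      also have "\<dots> \<le> card (bridges V adj h (k + n) v)" using v by (rule sum_card_bridges_le)
      finally show ?thesis by (simp add: add.commute)
    qed
    thus "\<exists>K. v \<in> V \<and> ?Q v w K" using v by blast
  next
    fix v v' K assume v: "v \<in> V" and vv: "same_orbit v v'" and Q: "v \<in> V \<and> ?Q v w K"
    have "card (bridges V adj h n w) \<le> card (bridges V adj h (n + K) v')" for n
      using order_trans[OF Q[THEN conjunct2, rule_format, of n] card_bridges_orbit_le[OF vv v]] .
    thus "v' \<in> V \<and> ?Q v' w K" using same_orbit_V[OF vv v] by blast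
  next
    fix v K K' assume "v \<in> V \<and> ?Q v w K" "K \<le> K'"
    thus "v \<in> V \<and> ?Q v w K'" using mono[of v w K K'] by blast
  qed
  note uniform = this
  have ex: "\<exists>K. \<forall>v\<in>V. ?Q v w K" if w: "w \<in> V" for w
  proof -
    from uniform[OF w] obtain K where K: "\<forall>v\<in>V. v \<in> V \<and> ?Q v w K" ..
    have "\<forall>v\<in>V. ?Q v w K" by (rule ballI, drule bspec[OF K], erule conjunct2)
    thus ?thesis ..
  qed
  show ?thesis
  proof (rule uniform_bound)
    show "\<exists>K. \<forall>v\<in>V. ?Q v w K" if "w \<in> V" for w using ex[OF that] .
  next
    fix w K K' assume "\<forall>v\<in>V. ?Q v w K" "K \<le> K'"
    thus "\<forall>v\<in>V. ?Q v w K'" using mono by blast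
  next
    fix w w' K assume w: "w \<in> V" and ww: "same_orbit w w'" and Q: "\<forall>v\<in>V. ?Q v w K"
    have "card (bridges V adj h n w') \<le> card (bridges V adj h n w)" for n
      using same_orbit_sym[OF ww w] same_orbit_V[OF ww w] by (rule card_bridges_orbit_le)
    thus "\<forall>v\<in>V. ?Q v w' K" using Q by (meson order_trans)
  qed
qed

text \<open>  All three facts come from one application of Fekete's lemma to the supermultiplicative sequence of
  minimal bridge counts.\<close>

lemma bridge_constant_limit:
  "(\<lambda>n. root n (real (min_bridges V adj h n))) \<longlonglongrightarrow> bridge_constant V adj h"
  and bridge_constant_ge_1: "1 \<le> bridge_constant V adj h"
  and min_bridges_le_power: "real (min_bridges V adj h n) \<le> bridge_constant V adj h ^ n"
proof -
  obtain D where D: "\<And>n. max_saws V adj n \<le> D ^ n" using max_saws_bound by blast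
  obtain \<beta> where \<beta>: "1 \<le> \<beta>" "(\<lambda>n. root n (real (min_bridges V adj h n))) \<longlonglongrightarrow> \<beta>"
      "\<And>n. real (min_bridges V adj h n) \<le> \<beta> ^ n"
    using Fekete_supermultiplicative[OF min_bridges_supermultiplicative min_bridges_pos
      order_trans[OF min_bridges_le_max_saws D]] by auto
  have "bridge_constant V adj h = \<beta>" unfolding bridge_constant_def using \<beta>(2) by (rule limI)
  thus "(\<lambda>n. root n (real (min_bridges V adj h n))) \<longlonglongrightarrow> bridge_constant V adj h"
    "1 \<le> bridge_constant V adj h" "real (min_bridges V adj h n) \<le> bridge_constant V adj h ^ n"
    using \<beta> by simp_all
qed

text \<open>  Bridges with the strict inequality at the start relaxed. Unlike bridges, these turn under reversal of the walk
  into their own mirror image with respect to the height, so that the pieces on both sides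
  of an extremum have the same form.\<close>

definition rising :: "nat \<Rightarrow> 'a \<Rightarrow> 'a list set" where
  "rising n v = {p \<in> saws V adj n v. \<forall>i\<in>{0..n}. h v \<le> h (p ! i) \<and> h (p ! i) \<le> h (p ! n)}"

text \<open>  Putting a lower neighbour in front of such a walk gives a bridge that is longer by one. The number of these
  is compared with the minimal number of bridges of some length, and that is at most a power of \<open>\<beta>\<close>.\<close>

lemma card_rising_le:
  "\<exists>A\<ge>1. \<forall>v\<in>V. \<forall>n. real (card (rising n v)) \<le> A * bridge_constant V adj h ^ n"
proof -
  let ?\<beta> = "bridge_constant V adj h"
  obtain K where K: "\<And>w v n. w \<in> V \<Longrightarrow> v \<in> V \<Longrightarrow>
      card (bridges V adj h n w) \<le> card (bridges V adj h (n + K) v)"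
    using card_bridges_compare by blast
  have "real (card (rising n v)) \<le> ?\<beta> ^ (K + 1) * ?\<beta> ^ n" if v: "v \<in> V" for v n
  proof -
    obtain z where z: "z \<in> V" "adj v z" "h z < h v" using exists_lower[OF v] by blast
    obtain w where w: "w \<in> V"
        "min_bridges V adj h (n + 1 + K) = card (bridges V adj h (n + 1 + K) w)"
      using min_bridges_attained by blast
    have "(#) z ` rising n v \<subseteq> bridges V adj h (n + 1) z"
    proof
      fix q assume "q \<in> (#) z ` rising n v"
      then obtain p where p: "q = z # p" "p \<in> saws V adj n v"
        and hp: "\<And>i. i \<le> n \<Longrightarrow> h v \<le> h (p ! i) \<and> h (p ! i) \<le> h (p ! n)"
        by (auto simp: rising_def)
      have len: "length p = n + 1" "p ! 0 = v" using p by (auto simp: saws_def walks_def)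
      have "z \<notin> set p"
      proof
        assume "z \<in> set p"
        then obtain i where "i \<le> n" "p ! i = z" using len by (auto simp: in_set_conv_nth less_Suc_eq_le)
        thus False using hp[of i] z by auto
      qed
      moreover have "adj ((z # p) ! i) ((z # p) ! (i + 1))" if "i < n + 1" for i
        using that p(2) len z(2) adj_commute by (cases i) (auto simp: saws_def walks_def)
      ultimately have "q \<in> saws V adj (n + 1) z"
        using p z len by (auto simp: saws_def walks_def)
      moreover have "h z < h (q ! i) \<and> h (q ! i) \<le> h (q ! (n + 1))" if "i \<in> {1..n + 1}" for i
        using hp[of "i - 1"] that p(1) z(3) by (cases i) auto
      ultimately show "q \<in> bridges V adj h (n + 1) z" by (simp add: bridges_def)
    qed
    hence "card (rising n v) \<le> card (bridges V adj h (n + 1) z)"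
      using finite_bridges[OF z(1)] by (intro card_inj_on_le[of "(#) z"]) auto
    also have "\<dots> \<le> min_bridges V adj h (n + 1 + K)" using K[OF z(1) w(1), of "n + 1"] w(2) by simp
    finally have "real (card (rising n v)) \<le> ?\<beta> ^ (n + 1 + K)"
      using min_bridges_le_power[of "n + 1 + K"] by linarith
    thus ?thesis by (simp add: power_add mult_ac)
  qed
  moreover have "1 \<le> ?\<beta> ^ (K + 1)" using bridge_constant_ge_1 by (rule one_le_power)
  ultimately show ?thesis by blast
qed

section \<open>Reversed bridges\<close>

text \<open>  Reversed bridges are the bridges for the height function \<open>- h\<close>, so all results on bridges carry over.\<close>

lemma height_graph_uminus: "height_graph V adj (\<lambda>x. - h x) \<Gamma>"
proof (rule height_graph.intro)
  have "\<exists>u\<in>V. \<exists>w\<in>V. adj v u \<and> adj v w \<and> - h u < - h v \<and> - h v < - h w" if "v \<in> V" for v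
    using exists_higher[OF that] exists_lower[OF that] by auto
  moreover have "- h (\<gamma> v) - - h (\<gamma> u) = - h v - - h u" if "\<gamma> \<in> \<Gamma>" "u \<in> V" "v \<in> V" for \<gamma> u v
    using translation(5)[OF that] by simp
  ultimately show "graph_height_function V adj (\<lambda>x. - h x) \<Gamma>"
    using height unfolding graph_height_function_def by blast
qed (use simple nonempty connected loc_finite in auto)

lemma bridges_uminus: "bridges V adj (\<lambda>x. - h x) n v = reversed_bridges V adj h n v"
  by (simp add: bridges_def reversed_bridges_def)

lemma min_bridges_uminus: "min_bridges V adj (\<lambda>x. - h x) = min_reversed_bridges V adj h"
  by (simp add: fun_eq_iff min_bridges_def min_reversed_bridges_def bridges_uminus)

lemma bridge_constant_uminus: "bridge_constant V adj (\<lambda>x. - h x) = reversed_bridge_constant V adj h"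
  by (simp add: bridge_constant_def reversed_bridge_constant_def min_bridges_uminus)

section \<open>Counting self-avoiding walks by their pieces\<close>

definition growth :: real where
  "growth = max (bridge_constant V adj h) (reversed_bridge_constant V adj h)"

lemma growth_ge_1: "1 \<le> growth"
  using bridge_constant_ge_1 by (simp add: growth_def)

definition pieces :: "nat \<Rightarrow> 'a \<Rightarrow> 'a list set" where
  "pieces n v = {p \<in> saws V adj n v. between_ends (\<lambda>i. h (p ! i)) 0 n}"

lemma card_pieces_le: "\<exists>B\<ge>1. \<forall>v\<in>V. \<forall>n. real (card (pieces n v)) \<le> B * growth ^ n"
proof -
  interpret neg: height_graph V adj "\<lambda>x. - h x" \<Gamma> by (rule height_graph_uminus)
  obtain A where A: "A \<ge> 1" "\<And>v n. v \<in> V \<Longrightarrow> real (card (rising n v)) \<le> A * bridge_constant V adj h ^ n"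
    using card_rising_le by blast
  obtain A' where A': "A' \<ge> 1"
      "\<And>v n. v \<in> V \<Longrightarrow> real (card (neg.rising n v)) \<le> A' * reversed_bridge_constant V adj h ^ n"
    using neg.card_rising_le unfolding bridge_constant_uminus by blast
  have "real (card (pieces n v)) \<le> (A + A') * growth ^ n" if v: "v \<in> V" for v n
  proof -
    have "pieces n v \<subseteq> rising n v \<union> neg.rising n v"
    proof
      fix p assume "p \<in> pieces n v"
      hence p: "p \<in> saws V adj n v" "between_ends (\<lambda>i. h (p ! i)) 0 n" by (auto simp: pieces_def)
      have "p ! 0 = v" using p(1) by (simp add: saws_def walks_def)
      thus "p \<in> rising n v \<union> neg.rising n v"
        using p by (auto simp: between_ends_def rising_def neg.rising_def)
    qed
    moreover have "finite (rising n v)" "finite (neg.rising n v)"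
      using finite_saws[OF v] by (auto simp: rising_def neg.rising_def)
    ultimately have "card (pieces n v) \<le> card (rising n v) + card (neg.rising n v)"
      by (meson card_Un_le card_mono finite_UnI order_trans)
    hence "real (card (pieces n v)) \<le> real (card (rising n v)) + real (card (neg.rising n v))"
      by linarith
    also have "\<dots> \<le> A * bridge_constant V adj h ^ n + A' * reversed_bridge_constant V adj h ^ n"
      using A(2)[OF v] A'(2)[OF v] by (rule add_mono)
    also have "\<dots> \<le> A * growth ^ n + A' * growth ^ n"
      using A(1) A'(1) bridge_constant_ge_1 neg.bridge_constant_ge_1 unfolding bridge_constant_uminus
      by (intro add_mono mult_left_mono power_mono) (auto simp: growth_def)
    finally show ?thesis by (simp add: algebra_simps)
  qed
  thus ?thesis using A(1) A'(1) by (intro exI[of _ "A + A'"]) auto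
qed

definition cut_saws :: "nat \<Rightarrow> nat \<Rightarrow> 'a \<Rightarrow> 'a list set" where
  "cut_saws k n v = {p \<in> saws V adj n v. cuttable (\<lambda>i. h (p ! i)) k 0 n}"

lemma cut_saws_Suc:
  assumes "p \<in> cut_saws (Suc k) n v"
  obtains j where "j \<le> n" "take (Suc j) p \<in> pieces j v" "drop j p \<in> cut_saws k (n - j) (p ! j)"
proof -
  have p: "p \<in> saws V adj n v" "cuttable (\<lambda>i. h (p ! i)) (Suc k) 0 n"
    using assms by (auto simp: cut_saws_def)
  from p(2) obtain j where j: "between_ends (\<lambda>i. h (p ! i)) 0 j" "cuttable (\<lambda>i. h (p ! i)) k j n"
    by (auto elim: cuttable.cases)
  have jn: "j \<le> n" using j(2) by (rule cuttable_le)
  have len: "length p = Suc n" using p(1) by (simp add: saws_def walks_def)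
  have "between_ends (\<lambda>i. h (take (Suc j) p ! i)) 0 j"
    using j(1) by (simp add: between_ends_def)
  hence "take (Suc j) p \<in> pieces j v"
    using saw_take_drop(1)[OF p(1) jn] by (simp add: pieces_def)
  moreover have "cuttable (\<lambda>i. h (p ! (j + i))) k 0 (n - j)"
    using cuttable_shift[of "\<lambda>i. h (p ! i)" k j 0 "n - j"] j(2) jn by simp
  hence "cuttable (\<lambda>i. h (drop j p ! i)) k 0 (n - j)" using jn len by simp
  hence "drop j p \<in> cut_saws k (n - j) (p ! j)"
    using saw_take_drop(2)[OF p(1) jn] by (simp add: cut_saws_def)
  ultimately show thesis using jn that by blast
qed

text \<open>  A walk cut into pieces is determined by the length \<open>j \<le> n\<close> of its first piece, that piece, and the rest. The powers
  of the growth rate multiply to \<open>growth ^ n\<close> whatever \<open>j\<close> is, so each cut costs only the factor \<open>B\<close> and the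
  number \<open>n + 1\<close> of possible \<open>j\<close>.\<close>

lemma card_cut_saws_le:
  assumes B: "B \<ge> 1" "\<And>v n. v \<in> V \<Longrightarrow> real (card (pieces n v)) \<le> B * growth ^ n" and "v \<in> V"
  shows "real (card (cut_saws k n v)) \<le> (B * (real n + 1)) ^ k * growth ^ n"
  using assms(3)
proof (induction k arbitrary: n v)
  case 0
  show ?case
  proof (cases "n = 0")
    case True
    have "cut_saws 0 n v \<subseteq> {[v]}" using walks_0[OF 0] True by (auto simp: cut_saws_def saws_def)
    hence "card (cut_saws 0 n v) \<le> 1" using card_mono[of "{[v]}"] by simp
    thus ?thesis using True by simp
  next
    case False
    hence "cut_saws 0 n v = {}" by (auto simp: cut_saws_def elim: cuttable.cases)
    thus ?thesis using growth_ge_1 by simp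
  qed
next
  case (Suc k)
  let ?C = "(B * (real n + 1)) ^ k"
  let ?T = "\<lambda>j. {p. take (Suc j) p \<in> pieces j v \<and> drop j p \<in> cut_saws k (n - j) (p ! j)}"
  have finp: "finite (pieces j u)" if "u \<in> V" for j u
    using finite_saws[OF that] by (simp add: pieces_def)
  have finc: "finite (cut_saws k j u)" if "u \<in> V" for j u
    using finite_saws[OF that] by (simp add: cut_saws_def)
  have endV: "q ! j \<in> V" if "q \<in> pieces j v" for q j
    using that walk_nth_V by (auto simp: pieces_def saws_def)
  have T: "finite (?T j) \<and> real (card (?T j)) \<le> B * ?C * growth ^ n" if j: "j \<le> n" for j
  proof -
    let ?S = "SIGMA q:pieces j v. cut_saws k (n - j) (q ! j)"
    let ?f = "\<lambda>p. (take (Suc j) p, drop j p)"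
    have finS: "finite ?S" using finp[OF Suc.prems] finc[OF endV] by (intro finite_SigmaI) auto
    have inj: "inj_on ?f (?T j)"
    proof (rule inj_onI)
      fix p q assume "?f p = ?f q"
      hence "take j (take (Suc j) p) = take j (take (Suc j) q)" "drop j p = drop j q" by simp_all
      hence "take j p = take j q" "drop j p = drop j q" by simp_all
      thus "p = q" by (metis append_take_drop_id)
    qed
    have sub: "?f ` ?T j \<subseteq> ?S" by auto
    have "finite (?T j)" using inj sub finS by (rule inj_on_finite)
    moreover have "real (card (?T j)) \<le> real (card ?S)"
      using card_inj_on_le[OF inj sub finS] by simp
    moreover have "real (card ?S) = (\<Sum>q\<in>pieces j v. real (card (cut_saws k (n - j) (q ! j))))"
      using finp[OF Suc.prems] finc[OF endV] by (subst card_SigmaI) auto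
    moreover have "\<dots> \<le> (\<Sum>q\<in>pieces j v. ?C * growth ^ (n - j))"
    proof (rule sum_mono)
      fix q assume "q \<in> pieces j v"
      hence "real (card (cut_saws k (n - j) (q ! j))) \<le> (B * (real (n - j) + 1)) ^ k * growth ^ (n - j)"
        using Suc.IH endV by blast
      also have "\<dots> \<le> ?C * growth ^ (n - j)"
        using B(1) growth_ge_1 by (intro mult_right_mono power_mono mult_left_mono) auto
      finally show "real (card (cut_saws k (n - j) (q ! j))) \<le> ?C * growth ^ (n - j)" .
    qed
    moreover have "(\<Sum>q\<in>pieces j v. ?C * growth ^ (n - j)) = real (card (pieces j v)) * (?C * growth ^ (n - j))"
      by simp
    moreover have "\<dots> \<le> (B * growth ^ j) * (?C * growth ^ (n - j))"
      using B growth_ge_1 Suc.prems by (intro mult_right_mono) auto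
    moreover have "\<dots> = B * ?C * growth ^ n"
    proof -
      have "growth ^ n = growth ^ j * growth ^ (n - j)" using j by (simp flip: power_add)
      thus ?thesis by (simp add: mult_ac)
    qed
    ultimately show ?thesis by linarith
  qed
  have "cut_saws (Suc k) n v \<subseteq> (\<Union>j\<in>{..n}. ?T j)"
    by (auto elim: cut_saws_Suc)
  hence "card (cut_saws (Suc k) n v) \<le> card (\<Union>j\<in>{..n}. ?T j)"
    using T by (intro card_mono) auto
  also have "\<dots> \<le> (\<Sum>j\<in>{..n}. card (?T j))" by (intro card_UN_le) auto
  finally have "real (card (cut_saws (Suc k) n v)) \<le> (\<Sum>j\<in>{..n}. real (card (?T j)))"
    by (simp flip: of_nat_sum)
  also have "\<dots> \<le> (\<Sum>j\<in>{..n}. B * ?C * growth ^ n)" using T by (intro sum_mono) auto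
  also have "\<dots> = (B * (real n + 1)) ^ Suc k * growth ^ n" by (simp add: algebra_simps)
  finally show ?case .
qed

lemma max_saws_le:
  "\<exists>B\<ge>1. \<exists>d::nat. d > 0 \<and> (\<forall>n>0. root n (real (max_saws V adj n)) \<le>
     (B * (real n + 1)) powr ((4 + 2 * sqrt (2 * real d * real n)) / real n) * growth)"
proof -
  obtain B where B: "B \<ge> 1" "\<And>v n. v \<in> V \<Longrightarrow> real (card (pieces n v)) \<le> B * growth ^ n"
    using card_pieces_le by blast
  obtain d' where d': "\<And>u v. adj u v \<Longrightarrow> \<bar>h v - h u\<bar> \<le> int d'"
    using height_step_bound by blast
  \<comment> \<open>A positive bound keeps the square root below from vanishing identically.\<close>
  define d where "d = Suc d'"
  have d: "\<bar>h v - h u\<bar> \<le> int d" if "adj u v" for u v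
    using d'[OF that] by (simp add: d_def)
  have "root n (real (max_saws V adj n)) \<le>
     (B * (real n + 1)) powr ((4 + 2 * sqrt (2 * real d * real n)) / real n) * growth" if n: "n > 0" for n
  proof -
    define t where "t = 4 + 2 * sqrt (2 * real d * real n)"
    define k where "k = nat \<lfloor>t\<rfloor>"
    define y where "y = B * (real n + 1)"
    have y: "y \<ge> 1" using B(1) mult_mono[of 1 B 1 "real n + 1"] by (simp add: y_def)
    have t: "real k \<le> t" unfolding k_def by (rule of_nat_floor) (simp add: t_def)
    obtain v where v: "v \<in> V" "max_saws V adj n = card (saws V adj n v)"
      using max_saws_attained by blast
    have "saws V adj n v \<subseteq> cut_saws k n v"
    proof
      fix p assume p: "p \<in> saws V adj n v"
      have "\<bar>h (p ! Suc i) - h (p ! i)\<bar> \<le> int d" if "i < n" for i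
        using p that by (intro d) (auto simp: saws_def walks_def)
      hence "cuttable (\<lambda>i. h (p ! i)) k 0 n"
        unfolding k_def t_def using cuttable_sqrt[of n "\<lambda>i. h (p ! i)" "int d"] by simp
      thus "p \<in> cut_saws k n v" using p by (simp add: cut_saws_def)
    qed
    moreover have "finite (cut_saws k n v)" using finite_saws[OF v(1)] by (simp add: cut_saws_def)
    ultimately have "real (max_saws V adj n) \<le> real (card (cut_saws k n v))"
      using v(2) card_mono by fastforce
    also have "\<dots> \<le> y ^ k * growth ^ n" unfolding y_def using B v(1) by (rule card_cut_saws_le)
    finally have "root n (real (max_saws V adj n)) \<le> root n (y ^ k * growth ^ n)"
      using n by simp
    also have "\<dots> = root n (y ^ k) * growth"
      using n growth_ge_1 by (simp add: real_root_mult real_root_power_cancel)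
    also have "root n (y ^ k) = y powr (real k / real n)"
      using n y by (simp add: root_powr_inverse powr_powr flip: powr_realpow)
    also have "y powr (real k / real n) * growth \<le> y powr (t / real n) * growth"
      using t n y growth_ge_1 by (intro mult_right_mono powr_mono divide_right_mono) auto
    finally show ?thesis by (simp add: y_def t_def)
  qed
  moreover have "d > 0" by (simp add: d_def)
  ultimately show ?thesis using B(1) by blast
qed

lemma connective_constant_eq_growth: "connective_constant V adj = growth"
proof -
  interpret neg: height_graph V adj "\<lambda>x. - h x" \<Gamma> by (rule height_graph_uminus)
  let ?c = "\<lambda>n. root n (real (max_saws V adj n))"
  obtain B d where B: "B \<ge> 1" "d > 0" and upper: "\<And>n. n > 0 \<Longrightarrow> ?c n \<le>
      (B * (real n + 1)) powr ((4 + 2 * sqrt (2 * real (d::nat) * real n)) / real n) * growth"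
    using max_saws_le by blast
  have "?c \<longlonglongrightarrow> growth"
  proof (rule tendsto_sandwich)
    show "eventually (\<lambda>n. max (root n (real (min_bridges V adj h n)))
        (root n (real (min_reversed_bridges V adj h n))) \<le> ?c n) sequentially"
      using eventually_gt_at_top[of 0]
      by eventually_elim (use min_bridges_le_max_saws neg.min_bridges_le_max_saws in
        \<open>simp add: min_bridges_uminus\<close>)
    show "(\<lambda>n. max (root n (real (min_bridges V adj h n)))
        (root n (real (min_reversed_bridges V adj h n)))) \<longlonglongrightarrow> growth"
      unfolding growth_def using bridge_constant_limit neg.bridge_constant_limit
      unfolding min_bridges_uminus bridge_constant_uminus by (rule tendsto_max)
    show "eventually (\<lambda>n. ?c n \<le>
        (B * (real n + 1)) powr ((4 + 2 * sqrt (2 * real d * real n)) / real n) * growth) sequentially"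
      using eventually_gt_at_top[of 0] by eventually_elim (rule upper)
    show "(\<lambda>n. (B * (real n + 1)) powr ((4 + 2 * sqrt (2 * real d * real n)) / real n) * growth) \<longlonglongrightarrow> growth"
      using B by (intro sqrt_many_factors_negligible) auto
  qed
  thus ?thesis unfolding connective_constant_def by (rule limI)
qed

end

theorem theorem3p2:
  fixes V :: "'a set" and adj :: "'a \<Rightarrow> 'a \<Rightarrow> bool"
    and h :: "'a \<Rightarrow> int" and \<Gamma> :: "('a \<Rightarrow> 'a) set"
  assumes "simple_graph V adj"
    and "infinite V"
    and "connected_graph V adj"
    and "locally_finite_graph V adj"
    and "quasi_transitive_graph V adj"
    and "graph_height_function V adj h \<Gamma>"
  shows "connective_constant V adj =
    max (bridge_constant V adj h) (reversed_bridge_constant V adj h)"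
proof -
  interpret height_graph V adj h \<Gamma>
    using assms by (intro height_graph.intro) auto
  show ?thesis using connective_constant_eq_growth by (simp add: growth_def)
qed

end
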